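(* Let $\mathbb{F}$ be a field of characteristic $2$, let $m=(m_1,m_2)$ be a pair of positive integers with $m\neq(1,1)$, and let $S=S(2,m)$ be the special Lie algebra over $\mathbb{F}$. Let $S'=[S,S]$ be its derived subalgebra. (a) If neither $m_1$ nor $m_2$ equals $1$, then $\dim_{\mathbb{F}}(S')=\dim_{\mathbb{F}}(S)-1$ and $S'$ is a simple Lie algebra. (b) If $m=(1,m_2)$, then $S'/N(S)\cong W(1,(m_2))'$ as Lie algebras, where $N(S)$ denotes the nilradical of $S$ and $W(1,(m_2))'$ is the derived subalgebra of the Witt algebra $W(1,(m_2))$ over $\mathbb{F}$.
   Context: Let $\mathbb{F}$ be a field of characteristic $p>0$ (here $p=2$), $n\ge 1$, and $m=(m_1,\dots,m_n)$ a tuple of positive integers. Put $\tau=(p^{m_1}-1,\dots,p^{m_n}-1)$. The (divided power) algebra $A(n,m)$ is the commutative associative unital $\mathbb{F}$-algebra with $\mathbb{F}$-basis the symbols $X^{(a)}$ (also written $X^a$), where $a=(a_1,\dots,a_n)$ runs over tuples of non-negative integers with $0\le a\le\tau$ componentwise, and multiplication $X^{(a)}X^{(b)}=\binom{a+b}{a}X^{(a+b)}$, where $\binom{a+b}{a}=\prod_{i}\binom{a_i+b_i}{a_i}$ is evaluated modulo $p$ (the product is $0$ when $a+b\not\le\tau$, since then the coefficient vanishes modulo $p$). For $1\le j\le n$, $D_j$ is the partial derivation of $A(n,m)$ in the $j$-th variable: $D_j(X^{(a)})=X^{(a-\varepsilon_j)}$ if $a_j\ge 1$ and $D_j(X^{(a)})=0$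 if $a_j=0$, with $\varepsilon_j$ the $j$-th unit vector. The Witt algebra $W(n,m)$ is the Lie algebra $\{\sum_{j=1}^n f_jD_j \mid f_j\in A(n,m)\}$ (a free $A(n,m)$-module on $D_1,\dots,D_n$) with bracket $[fD_i,gD_j]=fD_i(g)D_j-gD_j(f)D_i$. For $n>1$ let $\mathrm{div}:W(n,m)\to A(n,m)$, $\sum_{j=1}^n f_jD_j\mapsto\sum_{j=1}^n D_j(f_j)$. The special Lie algebra $S(n,m)$ is the derived subalgebra of the kernel of $\mathrm{div}$. The nilradical $N(L)$ of a finite-dimensional Lie algebra $L$ is its largest nilpotent ideal. A Lie algebra is simple if it is non-abelian and has no ideals other than $0$ and itself. *)

theory Defs
  imports
    "HOL-Computational_Algebra.Computational_Algebra"
    "HOL-Library.Function_Algebras"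
begin

section \<open>Lie algebras with explicit carriers\<close>

record ('k, 'v) lie_structure =
  lcarrier :: "'v set"
  ladd :: "'v \<Rightarrow> 'v \<Rightarrow> 'v"
  lzero :: 'v
  lscale :: "'k \<Rightarrow> 'v \<Rightarrow> 'v"
  lbracket :: "'v \<Rightarrow> 'v \<Rightarrow> 'v"

locale lie_algebra =
  fixes L :: "('k::field, 'v) lie_structure"
  assumes add_closed: "\<lbrakk>x \<in> lcarrier L; y \<in> lcarrier L\<rbrakk> \<Longrightarrow> ladd L x y \<in> lcarrier L"
    and zero_closed: "lzero L \<in> lcarrier L"
    and scale_closed: "x \<in> lcarrier L \<Longrightarrow> lscale L c x \<in> lcarrier L"
    and bracket_closed: "\<lbrakk>x \<in> lcarrier L; y \<in> lcarrier L\<rbrakk> \<Longrightarrow> lbracket L x y \<in> lcarrier L"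
    and add_assoc: "\<lbrakk>x \<in> lcarrier L; y \<in> lcarrier L; z \<in> lcarrier L\<rbrakk> \<Longrightarrow>
      ladd L (ladd L x y) z = ladd L x (ladd L y z)"
    and add_commute: "\<lbrakk>x \<in> lcarrier L; y \<in> lcarrier L\<rbrakk> \<Longrightarrow> ladd L x y = ladd L y x"
    and add_zero: "x \<in> lcarrier L \<Longrightarrow> ladd L (lzero L) x = x"
    and add_inverse: "x \<in> lcarrier L \<Longrightarrow> \<exists>y\<in>lcarrier L. ladd L x y = lzero L"
    and scale_one: "x \<in> lcarrier L \<Longrightarrow> lscale L 1 x = x"
    and scale_scale: "x \<in> lcarrier L \<Longrightarrow> lscale L c (lscale L d x) = lscale L (c * d) x"
    and scale_add_left: "x \<in> lcarrier L \<Longrightarrow>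
      lscale L (c + d) x = ladd L (lscale L c x) (lscale L d x)"
    and scale_add_right: "\<lbrakk>x \<in> lcarrier L; y \<in> lcarrier L\<rbrakk> \<Longrightarrow>
      lscale L c (ladd L x y) = ladd L (lscale L c x) (lscale L c y)"
    and bracket_add_left: "\<lbrakk>x \<in> lcarrier L; y \<in> lcarrier L; z \<in> lcarrier L\<rbrakk> \<Longrightarrow>
      lbracket L (ladd L x y) z = ladd L (lbracket L x z) (lbracket L y z)"
    and bracket_add_right: "\<lbrakk>x \<in> lcarrier L; y \<in> lcarrier L; z \<in> lcarrier L\<rbrakk> \<Longrightarrow>
      lbracket L x (ladd L y z) = ladd L (lbracket L x y) (lbracket L x z)"
    and bracket_scale_left: "\<lbrakk>x \<in> lcarrier L; y \<in> lcarrier L\<rbrakk> \<Longrightarrow>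
      lbracket L (lscale L c x) y = lscale L c (lbracket L x y)"
    and bracket_scale_right: "\<lbrakk>x \<in> lcarrier L; y \<in> lcarrier L\<rbrakk> \<Longrightarrow>
      lbracket L x (lscale L c y) = lscale L c (lbracket L x y)"
    and bracket_self: "x \<in> lcarrier L \<Longrightarrow> lbracket L x x = lzero L"
    and jacobi: "\<lbrakk>x \<in> lcarrier L; y \<in> lcarrier L; z \<in> lcarrier L\<rbrakk> \<Longrightarrow>
      ladd L (lbracket L x (lbracket L y z))
        (ladd L (lbracket L y (lbracket L z x)) (lbracket L z (lbracket L x y))) = lzero L"

definition lie_subspace :: "('k, 'v) lie_structure \<Rightarrow> 'v set \<Rightarrow> bool" where
  "lie_subspace L U \<longleftrightarrow> U \<subseteq> lcarrier L \<and> lzero L \<in> U \<and>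
     (\<forall>x\<in>U. \<forall>y\<in>U. ladd L x y \<in> U) \<and> (\<forall>c. \<forall>x\<in>U. lscale L c x \<in> U)"

definition lie_span :: "('k, 'v) lie_structure \<Rightarrow> 'v set \<Rightarrow> 'v set" where
  "lie_span L X = \<Inter>{U. lie_subspace L U \<and> X \<subseteq> U}"

definition lie_commutator :: "('k, 'v) lie_structure \<Rightarrow> 'v set \<Rightarrow> 'v set \<Rightarrow> 'v set" where
  "lie_commutator L A B = lie_span L {lbracket L x y | x y. x \<in> A \<and> y \<in> B}"

definition lie_derived :: "('k, 'v) lie_structure \<Rightarrow> ('k, 'v) lie_structure" where
  "lie_derived L = L\<lparr>lcarrier := lie_commutator L (lcarrier L) (lcarrier L)\<rparr>"

definition lie_ideal :: "('k, 'v) lie_structure \<Rightarrow> 'v set \<Rightarrow> bool" where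
  "lie_ideal L I \<longleftrightarrow> lie_subspace L I \<and> (\<forall>x\<in>lcarrier L. \<forall>y\<in>I. lbracket L x y \<in> I)"

definition simple_lie_algebra :: "('k::field, 'v) lie_structure \<Rightarrow> bool" where
  "simple_lie_algebra L \<longleftrightarrow> lie_algebra L \<and>
     (\<exists>x\<in>lcarrier L. \<exists>y\<in>lcarrier L. lbracket L x y \<noteq> lzero L) \<and>
     (\<forall>I. lie_ideal L I \<longrightarrow> I = {lzero L} \<or> I = lcarrier L)"

primrec lower_central :: "('k, 'v) lie_structure \<Rightarrow> nat \<Rightarrow> 'v set" where
  "lower_central L 0 = lcarrier L"
| "lower_central L (Suc k) = lie_commutator L (lcarrier L) (lower_central L k)"

definition lie_nilpotent :: "('k, 'v) lie_structure \<Rightarrow> bool" where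
  "lie_nilpotent L \<longleftrightarrow> (\<exists>k. lower_central L k = {lzero L})"

definition nilradical :: "('k, 'v) lie_structure \<Rightarrow> 'v set" where
  "nilradical L = (GREATEST I. lie_ideal L I \<and> lie_nilpotent (L\<lparr>lcarrier := I\<rparr>))"

text \<open>
  The quotient by an ideal \<open>I\<close> has the cosets of \<open>I\<close> as elements. Since \<open>I\<close> is added
  in scalar multiples and brackets, all operations yield full cosets.
\<close>

definition lie_coset :: "('k, 'v) lie_structure \<Rightarrow> 'v set \<Rightarrow> 'v \<Rightarrow> 'v set" where
  "lie_coset L I x = {ladd L x i | i. i \<in> I}"

definition lie_quotient ::
    "('k, 'v) lie_structure \<Rightarrow> 'v set \<Rightarrow> ('k, 'v set) lie_structure" where
  "lie_quotient L I =
     \<lparr>lcarrier = lie_coset L I ` lcarrier L,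
      ladd = (\<lambda>A B. {ladd L a b | a b. a \<in> A \<and> b \<in> B}),
      lzero = I,
      lscale = (\<lambda>c A. {ladd L (lscale L c a) i | a i. a \<in> A \<and> i \<in> I}),
      lbracket = (\<lambda>A B. {ladd L (lbracket L a b) i | a b i. a \<in> A \<and> b \<in> B \<and> i \<in> I})\<rparr>"

definition lie_isomorphic ::
    "('k, 'v) lie_structure \<Rightarrow> ('k, 'w) lie_structure \<Rightarrow> bool" where
  "lie_isomorphic L M \<longleftrightarrow> (\<exists>\<phi>. bij_betw \<phi> (lcarrier L) (lcarrier M) \<and>
     (\<forall>x\<in>lcarrier L. \<forall>y\<in>lcarrier L. \<phi> (ladd L x y) = ladd M (\<phi> x) (\<phi> y)) \<and>
     (\<forall>c. \<forall>x\<in>lcarrier L. \<phi> (lscale L c x) = lscale M c (\<phi> x)) \<and>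
     (\<forall>x\<in>lcarrier L. \<forall>y\<in>lcarrier L. \<phi> (lbracket L x y) = lbracket M (\<phi> x) (\<phi> y)))"


section \<open>Divided power algebras\<close>

text \<open>
  Variables are indexed by \<open>{1..n}\<close>; multi-indices and the tuple \<open>m\<close> are functions on
  \<open>nat\<close>. Multi-indices vanish outside \<open>{1..n}\<close>, and values of \<open>m\<close> outside \<open>{1..n}\<close> are
  irrelevant. An element of the algebra is the function sending a multi-index \<open>a\<close> to the
  coefficient of \<open>X\<^sup>(\<^sup>a\<^sup>)\<close>.
\<close>

type_synonym 'a dp = "(nat \<Rightarrow> nat) \<Rightarrow> 'a"

definition multi_indices :: "nat \<Rightarrow> nat \<Rightarrow> (nat \<Rightarrow> nat) \<Rightarrow> (nat \<Rightarrow> nat) set" where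
  "multi_indices p n m =
     {a. (\<forall>i\<in>{1..n}. a i \<le> p ^ m i - 1) \<and> (\<forall>i. i \<notin> {1..n} \<longrightarrow> a i = 0)}"

definition dp_carrier :: "nat \<Rightarrow> (nat \<Rightarrow> nat) \<Rightarrow> 'a::field dp set" where
  "dp_carrier n m = {f. \<forall>a. f a \<noteq> 0 \<longrightarrow> a \<in> multi_indices CHAR('a) n m}"

definition dp_mult :: "nat \<Rightarrow> (nat \<Rightarrow> nat) \<Rightarrow> 'a::field dp \<Rightarrow> 'a dp \<Rightarrow> 'a dp" where
  "dp_mult n m f g = (\<lambda>c. if c \<in> multi_indices CHAR('a) n m
     then \<Sum>(a, b) \<in> {(a, b) \<in> multi_indices CHAR('a) n m \<times> multi_indices CHAR('a) n m.
                      a + b = c}.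
            (\<Prod>i=1..n. of_nat ((a i + b i) choose a i)) * f a * g b
     else 0)"

definition dp_deriv :: "nat \<Rightarrow> 'a dp \<Rightarrow> 'a dp" where
  "dp_deriv j f = (\<lambda>a. f (a(j := Suc (a j))))"

definition dp_monom :: "(nat \<Rightarrow> nat) \<Rightarrow> 'a::field dp" where
  "dp_monom a = (\<lambda>b. if b = a then 1 else 0)"

lemma dp_monom_closed:
  "a \<in> multi_indices CHAR('a) n m \<Longrightarrow> dp_monom a \<in> (dp_carrier n m :: 'a::field dp set)"
  by (simp add: dp_carrier_def dp_monom_def)

lemma finite_multi_indices: "finite (multi_indices p n m)"
proof (rule finite_subset)
  let ?B = "\<Union>i\<in>{1..n}. {0..p ^ m i - 1}"
  show "multi_indices p n m \<subseteq> {a. \<forall>i. (i \<in> {1..n} \<longrightarrow> a i \<in> ?B) \<and> (i \<notin> {1..n} \<longrightarrow> a i = 0)}"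
    unfolding multi_indices_def by fastforce
  show "finite {a. \<forall>i. (i \<in> {1..n} \<longrightarrow> a i \<in> ?B) \<and> (i \<notin> {1..n} \<longrightarrow> a i = 0)}"
    by (rule finite_set_of_finite_funs) auto
qed

lemma dp_mult_monom:
  assumes "a \<in> multi_indices CHAR('a) n m" "b \<in> multi_indices CHAR('a) n m"
  shows "dp_mult n m (dp_monom a) (dp_monom b :: 'a::field dp) =
    (if a + b \<in> multi_indices CHAR('a) n m
     then (\<lambda>c. (\<Prod>i=1..n. of_nat ((a i + b i) choose a i)) * dp_monom (a + b) c) else 0)"
proof
  fix c
  let ?I = "multi_indices CHAR('a) n m"
  let ?P = "{(a, b) \<in> ?I \<times> ?I. a + b = c}"
  let ?t = "\<lambda>a' b'. (\<Prod>i=1..n. of_nat ((a' i + b' i) choose a' i)) *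
      dp_monom a a' * (dp_monom b b' :: 'a)"
  have fin: "finite ?P"
    by (rule finite_subset[of _ "?I \<times> ?I"]) (auto simp: finite_multi_indices)
  have "(\<Sum>(a', b')\<in>?P. ?t a' b') = (\<Sum>q\<in>?P. if q = (a, b) then ?t a b else 0)"
    by (rule sum.cong) (auto simp: dp_monom_def split: if_splits)
  also have "\<dots> = (if (a, b) \<in> ?P then ?t a b else 0)"
    using fin by simp
  finally show "dp_mult n m (dp_monom a) (dp_monom b :: 'a dp) c =
    (if a + b \<in> ?I
     then (\<lambda>c. (\<Prod>i=1..n. of_nat ((a i + b i) choose a i)) * dp_monom (a + b) c) else 0) c"
    using assms by (auto simp: dp_mult_def dp_monom_def)
qed

lemma dp_deriv_monom:
  "dp_deriv j (dp_monom a :: 'a::field dp) =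
     (if 1 \<le> a j then dp_monom (a(j := a j - 1)) else 0)"
  by (rule ext) (auto simp: dp_deriv_def dp_monom_def fun_eq_iff)


section \<open>Witt algebras and special Lie algebras\<close>

text \<open>
  The derivation \<open>\<Sum>j=1..n. f\<^sub>j D\<^sub>j\<close> is represented by its coefficient tuple \<open>j \<mapsto> f\<^sub>j\<close>, with
  \<open>f\<^sub>j = 0\<close> outside \<open>{1..n}\<close>; sums and zeros of such tuples are pointwise.
\<close>

type_synonym 'a witt_elem = "nat \<Rightarrow> 'a dp"

definition witt_scale :: "'a::field \<Rightarrow> 'a witt_elem \<Rightarrow> 'a witt_elem" where
  "witt_scale c u = (\<lambda>j a. c * u j a)"

lemma vector_space_witt_scale: "vector_space (witt_scale :: 'a::field \<Rightarrow> _)"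
  by unfold_locales (simp_all add: witt_scale_def fun_eq_iff algebra_simps)

definition witt_bracket ::
    "nat \<Rightarrow> (nat \<Rightarrow> nat) \<Rightarrow> 'a::field witt_elem \<Rightarrow> 'a witt_elem \<Rightarrow> 'a witt_elem" where
  "witt_bracket n m u v = (\<lambda>k. \<Sum>i=1..n.
     dp_mult n m (u i) (dp_deriv i (v k)) - dp_mult n m (v i) (dp_deriv i (u k)))"

definition witt :: "nat \<Rightarrow> (nat \<Rightarrow> nat) \<Rightarrow> ('a::field, 'a witt_elem) lie_structure" where
  "witt n m =
     \<lparr>lcarrier = {u. (\<forall>j\<in>{1..n}. u j \<in> dp_carrier n m) \<and> (\<forall>j. j \<notin> {1..n} \<longrightarrow> u j = 0)},
      ladd = (+), lzero = 0, lscale = witt_scale, lbracket = witt_bracket n m\<rparr>"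

definition witt_term :: "'a::field dp \<Rightarrow> nat \<Rightarrow> 'a witt_elem" where
  "witt_term f j = (\<lambda>k. if k = j then f else 0)"

lemma witt_bracket_term:
  assumes "i \<in> {1..n}" "j \<in> {1..n}"
  shows "witt_bracket n m (witt_term f i) (witt_term g j) =
    witt_term (dp_mult n m f (dp_deriv i g)) j - witt_term (dp_mult n m g (dp_deriv j f)) i"
proof
  fix k
  have zl: "dp_mult n m 0 h = 0" and zr: "dp_mult n m h 0 = 0" for h :: "'a dp"
    by (auto simp: dp_mult_def fun_eq_iff split_def)
  have zd: "dp_deriv l (0 :: 'a dp) = 0" for l
    by (simp add: dp_deriv_def fun_eq_iff)
  have l: "dp_mult n m (if l = i then f else 0) (dp_deriv l (if k = j then g else 0)) =
      (if l = i then (if k = j then dp_mult n m f (dp_deriv i g) else 0) else 0)"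
    and r: "dp_mult n m (if l = j then g else 0) (dp_deriv l (if k = i then f else 0)) =
      (if l = j then (if k = i then dp_mult n m g (dp_deriv j f) else 0) else 0)" for l
    by (auto simp: zl zr zd)
  show "witt_bracket n m (witt_term f i) (witt_term g j) k =
    (witt_term (dp_mult n m f (dp_deriv i g)) j - witt_term (dp_mult n m g (dp_deriv j f)) i) k"
    unfolding witt_bracket_def witt_term_def l r sum_subtractf
    using assms by (simp add: sum.delta)
qed

definition witt_div :: "nat \<Rightarrow> 'a::field witt_elem \<Rightarrow> 'a dp" where
  "witt_div n u = (\<Sum>j=1..n. dp_deriv j (u j))"

definition special :: "nat \<Rightarrow> (nat \<Rightarrow> nat) \<Rightarrow> ('a::field, 'a witt_elem) lie_structure" where
  "special n m =
     lie_derived ((witt n m)\<lparr>lcarrier := {u \<in> lcarrier (witt n m). witt_div n u = 0}\<rparr>)"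

end

theory Submission
  imports Defs
begin

text \<open>
  In two variables, let \<open>ham f = (D2 f) D1 - (D1 f) D2\<close>. If \<open>u\<close> and \<open>v\<close> are divergence free, then
  \<open>[u, v] = ham (u2 v1 - u1 v2)\<close>. Every monomial except the top one is a derivative, and the top one
  arises from the two divergence-free fields whose potentials \<open>X^(\<tau>1 + 1, 0)\<close> and \<open>X^(0, \<tau>2 + 1)\<close>
  are missing from \<open>A\<close>; so \<open>S = ham A\<close>. A bracket of elements of \<open>ham A\<close> has a potential in \<open>D1 A + D2 A\<close>, which
  has no top monomial; so \<open>S'\<close> consists of the \<open>ham f\<close> with \<open>f\<close> lacking the top monomial. Any nonzero ideal
  of \<open>S'\<close> contains, after applying \<open>D1\<close> and \<open>D2\<close>, a nonzero constant field. If both \<open>\<tau>i \<ge> 2\<close>, brackets with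
  \<open>ham X^(2, 0)\<close> and \<open>ham X^(0, 2)\<close> yield \<open>D1\<close> and \<open>D2\<close>, hence everything. If \<open>\<tau>1 = 1\<close>, then
  \<open>S = {ham (g + x1 h)}\<close> with \<open>g\<close> and \<open>h\<close> in the second variable, \<open>ham (g + x1 h) \<mapsto> h D\<close> is a homomorphism
  onto \<open>W(1, m2)\<close> up to sign, and its abelian kernel \<open>{ham g}\<close> is the nilradical.
\<close>

section \<open>Subalgebras, spans and quotients\<close>

context lie_algebra
begin

lemma scale_zero_left:
  assumes "x \<in> lcarrier L"
  shows "lscale L 0 x = lzero L"
proof -
  let ?z = "lscale L 0 x"
  have z: "?z \<in> lcarrier L" using assms by (rule scale_closed)
  then obtain y where y: "y \<in> lcarrier L" "ladd L ?z y = lzero L" using add_inverse by blast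
  have "ladd L ?z ?z = ?z" using scale_add_left[OF assms, of 0 0] by simp
  then have "lzero L = ladd L (ladd L ?z ?z) y" using y by simp
  also have "\<dots> = ladd L ?z (lzero L)" using add_assoc[OF z z y(1)] y by simp
  finally show ?thesis using add_commute[OF z zero_closed] add_zero[OF z] by simp
qed

lemma subalgebra:
  assumes U: "lie_subspace L U" and br: "\<And>x y. x \<in> U \<Longrightarrow> y \<in> U \<Longrightarrow> lbracket L x y \<in> U"
  shows "lie_algebra (L\<lparr>lcarrier := U\<rparr>)"
proof -
  have sub: "x \<in> lcarrier L" if "x \<in> U" for x using U that by (auto simp: lie_subspace_def)
  \<comment> \<open>\<open>lie_subspace\<close> does not mention inverses; closure under scaling by
    -1 supplies them.\<close>
  have inv: "\<exists>y\<in>U. ladd L x y = lzero L" if "x \<in> U" for x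
  proof
    show "lscale L (- 1) x \<in> U" using U that by (auto simp: lie_subspace_def)
    have "lscale L (1 + (- 1)) x = ladd L x (lscale L (- 1) x)"
      using scale_add_left[OF sub[OF that], of 1 "- 1"] scale_one[OF sub[OF that]] by simp
    then show "ladd L x (lscale L (- 1) x) = lzero L" using scale_zero_left[OF sub[OF that]] by simp
  qed
  show ?thesis
    using U br inv
    by unfold_locales
      (auto simp: lie_subspace_def sub add_assoc add_zero scale_one scale_scale
        scale_add_left scale_add_right bracket_add_left bracket_add_right bracket_scale_left
        bracket_scale_right bracket_self jacobi intro: add_commute)
qed

lemma lie_subspace_carrier: "lie_subspace L (lcarrier L)"
  by (auto simp: lie_subspace_def add_closed zero_closed scale_closed)

lemma lie_subspace_span:
  assumes "X \<subseteq> lcarrier L"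
  shows "lie_subspace L (lie_span L X)"
  using lie_subspace_carrier assms unfolding lie_subspace_def lie_span_def by blast

text \<open>The span stays inside the carrier, so the bracket of two of its elements is itself a
  generator; no induction over the span is involved.\<close>

lemma lie_algebra_derived: "lie_algebra (lie_derived L)"
proof -
  let ?X = "{lbracket L x y | x y. x \<in> lcarrier L \<and> y \<in> lcarrier L}"
  have X: "?X \<subseteq> lcarrier L" using bracket_closed by auto
  have s: "lie_subspace L (lie_span L ?X)" by (rule lie_subspace_span[OF X])
  then have "lie_span L ?X \<subseteq> lcarrier L" by (simp add: lie_subspace_def)
  moreover have "?X \<subseteq> lie_span L ?X" unfolding lie_span_def by blast
  ultimately have "lbracket L x y \<in> lie_span L ?X"
    if "x \<in> lie_span L ?X" "y \<in> lie_span L ?X" for x y using that by blast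
  then show ?thesis
    unfolding lie_derived_def lie_commutator_def by (intro subalgebra[OF s])
qed

end

lemma lie_span_eqI:
  assumes "lie_subspace L U" and "X \<subseteq> U"
    and "\<And>V. lie_subspace L V \<Longrightarrow> X \<subseteq> V \<Longrightarrow> U \<subseteq> V"
  shows "lie_span L X = U"
  using assms unfolding lie_span_def by blast

text \<open>The first isomorphism theorem, for quotients whose elements are cosets and whose
  operations are defined on sets.\<close>

lemma lie_isomorphic_quotient:
  assumes L: "lie_algebra L" and M: "lie_algebra M"
    and onto: "\<psi> ` lcarrier L = lcarrier M"
    and add: "\<And>x y. x \<in> lcarrier L \<Longrightarrow> y \<in> lcarrier L \<Longrightarrow> \<psi> (ladd L x y) = ladd M (\<psi> x) (\<psi> y)"
    and scale: "\<And>c x. x \<in> lcarrier L \<Longrightarrow> \<psi> (lscale L c x) = lscale M c (\<psi> x)"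
    and bracket: "\<And>x y. x \<in> lcarrier L \<Longrightarrow> y \<in> lcarrier L \<Longrightarrow>
      \<psi> (lbracket L x y) = lbracket M (\<psi> x) (\<psi> y)"
    and J: "J = {x \<in> lcarrier L. \<psi> x = lzero M}"
  shows "lie_isomorphic (lie_quotient L J) M"
proof -
  interpret L: lie_algebra L by (rule L)
  interpret M: lie_algebra M by (rule M)
  \<comment> \<open>The image of a coset under \<open>\<psi>\<close> is a singleton, so
    \<open>the_elem\<close> reads off the induced map without choosing representatives.\<close>
  let ?\<phi> = "\<lambda>A. the_elem (\<psi> ` A)"
  have im: "\<psi> x \<in> lcarrier M" if "x \<in> lcarrier L" for x using onto that by blast
  have zero: "\<psi> (lzero L) = lzero M"
    using scale[OF L.zero_closed, of 0] L.scale_zero_left[OF L.zero_closed]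
      M.scale_zero_left[OF im[OF L.zero_closed]] by simp
  have JL: "i \<in> lcarrier L" and J0: "\<psi> i = lzero M" if "i \<in> J" for i using that J by auto
  have zJ: "lzero L \<in> J" using J zero L.zero_closed by simp
  have addM0: "ladd M y (lzero M) = y" if "y \<in> lcarrier M" for y
    using M.add_commute[OF that M.zero_closed] M.add_zero[OF that] by simp
  have addL0: "ladd L y (lzero L) = y" if "y \<in> lcarrier L" for y
    using L.add_commute[OF that L.zero_closed] L.add_zero[OF that] by simp
  have \<psi>J: "\<psi> (ladd L x i) = \<psi> x" if "x \<in> lcarrier L" "i \<in> J" for x i
    using that add JL J0 addM0 im by simp
  have cos: "\<psi> a = \<psi> x" "a \<in> lcarrier L" if "a \<in> lie_coset L J x" "x \<in> lcarrier L" for a x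
    using that \<psi>J L.add_closed JL by (auto simp: lie_coset_def)
  have self: "x \<in> lie_coset L J x" if "x \<in> lcarrier L" for x
    using zJ addL0[OF that] unfolding lie_coset_def by force
  have \<phi>: "?\<phi> A = y" if "\<And>a. a \<in> A \<Longrightarrow> \<psi> a = y" "A \<noteq> {}" for A y
  proof -
    have "\<psi> ` A = {y}" using that by (auto simp: image_def)
    then show ?thesis by simp
  qed
  have \<phi>cos: "?\<phi> (lie_coset L J x) = \<psi> x" if "x \<in> lcarrier L" for x
    by (rule \<phi>, use that in \<open>force dest: cos\<close>) (use that self in blast)
  \<comment> \<open>With \<open>w\<close> the inverse of \<open>y\<close>, the element x + j equals
    y + ((w + x) + j), and the second summand lies in the kernel.\<close>
  have sub: "lie_coset L J x \<subseteq> lie_coset L J y"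
    if x: "x \<in> lcarrier L" and y: "y \<in> lcarrier L" and eq: "\<psi> x = \<psi> y" for x y
  proof
    fix z assume "z \<in> lie_coset L J x"
    then obtain j where j: "j \<in> J" "z = ladd L x j" by (auto simp: lie_coset_def)
    obtain w where w: "w \<in> lcarrier L" "ladd L y w = lzero L" using L.add_inverse[OF y] by blast
    let ?i = "ladd L (ladd L w x) j"
    have wx: "ladd L w x \<in> lcarrier L" using w x L.add_closed by simp
    have "\<psi> ?i = \<psi> (ladd L w x)" using \<psi>J[OF wx j(1)] .
    also have "\<dots> = \<psi> (ladd L y w)" 
      using add[OF w(1) x] add[OF y w(1)] eq M.add_commute[OF im[OF y] im[OF w(1)]] by simp
    finally have "?i \<in> J" using w zero J wx L.add_closed JL[OF j(1)] by simp
    moreover have "ladd L y ?i = ladd L (ladd L (ladd L y w) x) j"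
      using L.add_assoc[OF y wx JL[OF j(1)]] L.add_assoc[OF y w(1) x] by simp
    then have "ladd L y ?i = z" using w L.add_zero[OF x] j by simp
    ultimately show "z \<in> lie_coset L J y" unfolding lie_coset_def by force
  qed
  have "inj_on ?\<phi> (lie_coset L J ` lcarrier L)"
    by (rule inj_onI, elim imageE) (simp add: \<phi>cos sub subset_antisym)
  moreover have "?\<phi> ` lie_coset L J ` lcarrier L = lcarrier M"
    using \<phi>cos onto by (simp add: image_image cong: image_cong)
  ultimately have "bij_betw ?\<phi> (lie_coset L J ` lcarrier L) (lcarrier M)"
    by (simp add: bij_betw_def)
  \<comment> \<open>For each quotient operation, \<open>\<psi>\<close> takes a single value on the
    resulting nonempty set, namely the corresponding operation in \<open>M\<close>.\<close>
  moreover have "?\<phi> {ladd L a b | a b. a \<in> lie_coset L J x \<and> b \<in> lie_coset L J y} =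
      ladd M (\<psi> x) (\<psi> y)" if "x \<in> lcarrier L" "y \<in> lcarrier L" for x y
  proof (rule \<phi>)
    fix z assume "z \<in> {ladd L a b | a b. a \<in> lie_coset L J x \<and> b \<in> lie_coset L J y}"
    then obtain a b where "a \<in> lie_coset L J x" "b \<in> lie_coset L J y" "z = ladd L a b" by blast
    then show "\<psi> z = ladd M (\<psi> x) (\<psi> y)" using cos[of a x] cos[of b y] that by (simp add: add)
  qed (use that self in blast)
  moreover have "?\<phi> {ladd L (lscale L c a) i | a i. a \<in> lie_coset L J x \<and> i \<in> J} =
      lscale M c (\<psi> x)" if "x \<in> lcarrier L" for x c
  proof (rule \<phi>)
    fix z assume "z \<in> {ladd L (lscale L c a) i | a i. a \<in> lie_coset L J x \<and> i \<in> J}"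
    then obtain a i where "a \<in> lie_coset L J x" "i \<in> J" "z = ladd L (lscale L c a) i" by blast
    then show "\<psi> z = lscale M c (\<psi> x)" using cos[of a x] that by (simp add: \<psi>J scale L.scale_closed)
  qed (use that self zJ in blast)
  moreover have "?\<phi> {ladd L (lbracket L a b) i | a b i.
        a \<in> lie_coset L J x \<and> b \<in> lie_coset L J y \<and> i \<in> J} = lbracket M (\<psi> x) (\<psi> y)"
    if "x \<in> lcarrier L" "y \<in> lcarrier L" for x y
  proof (rule \<phi>)
    fix z assume "z \<in> {ladd L (lbracket L a b) i | a b i.
      a \<in> lie_coset L J x \<and> b \<in> lie_coset L J y \<and> i \<in> J}"
    then obtain a b i where "a \<in> lie_coset L J x" "b \<in> lie_coset L J y" "i \<in> J"
      "z = ladd L (lbracket L a b) i" by blast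
    then show "\<psi> z = lbracket M (\<psi> x) (\<psi> y)"
      using cos[of a x] cos[of b y] that by (simp add: \<psi>J bracket L.bracket_closed)
  qed (use that self zJ in blast)
  ultimately show ?thesis
    unfolding lie_isomorphic_def lie_quotient_def
    by (intro exI[of _ ?\<phi>]) (auto simp: \<phi>cos)
qed

section \<open>The divided power algebra\<close>

text \<open>The structure constant of \<open>dp_mult\<close>, isolated so that binomial identities
  can be proved before any sums appear.\<close>

definition mbinom :: "nat \<Rightarrow> (nat \<Rightarrow> nat) \<Rightarrow> (nat \<Rightarrow> nat) \<Rightarrow> 'a::field" where
  "mbinom n a b = (\<Prod>i=1..n. of_nat ((a i + b i) choose a i))"

lemma mbinom_commute: "mbinom n a b = mbinom n b a"
  unfolding mbinom_def
  by (rule prod.cong) (simp_all add: binomial_symmetric[of "a _" "a _ + b _"] add.commute)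

text \<open>In each coordinate both sides are the same trinomial coefficient. The identity is proved
  in the natural numbers and then mapped to the field.\<close>

lemma mbinom_assoc:
  "(mbinom n (a + b) c * mbinom n a b :: 'a::field) = mbinom n a (b + c) * mbinom n b c"
proof -
  have "((x + y + z) choose (x + y)) * ((x + y) choose x) =
      ((x + y + z) choose x) * ((y + z) choose y)" for x y z :: nat
    using choose_mult[of x "x + y" "x + y + z"] by (simp add: add.assoc)
  then have "of_nat ((x + y + z) choose (x + y)) * of_nat ((x + y) choose x) =
      (of_nat ((x + (y + z)) choose x) * of_nat ((y + z) choose y) :: 'a)" for x y z :: nat
    by (simp add: add.assoc flip: of_nat_mult)
  then show ?thesis unfolding mbinom_def by (simp flip: prod.distrib)
qed

lemma mbinom_split:
  assumes "j \<in> {1..n}"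
  shows "(mbinom n a b :: 'a::field) =
    of_nat ((a j + b j) choose a j) * (\<Prod>i\<in>{1..n} - {j}. of_nat ((a i + b i) choose a i))"
  unfolding mbinom_def using assms by (simp add: prod.remove)

text \<open>Pascal's rule in coordinate \<open>j\<close>; the other coordinates give a common
  factor. This is the coefficient form of the product rule for D_j.\<close>

lemma mbinom_pascal:
  assumes "j \<in> {1..n}"
  shows "(mbinom n (a(j := Suc (a j))) (b(j := Suc (b j))) :: 'a::field) =
    mbinom n a (b(j := Suc (b j))) + mbinom n (a(j := Suc (a j))) b"
proof -
  have "(\<Prod>i\<in>{1..n} - {j}. of_nat (((a(j := x)) i + (b(j := y)) i) choose (a(j := x)) i)) =
      (\<Prod>i\<in>{1..n} - {j}. of_nat ((a i + b i) choose a i) :: 'a)" for x y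
    by (rule prod.cong) auto
  from this[of "a j" "Suc (b j)"] this[of "Suc (a j)" "b j"] this show ?thesis
    by (simp add: mbinom_split[OF assms] algebra_simps)
qed

text \<open>Replaces Pascal's rule where one exponent in coordinate \<open>j\<close> is zero: the
  binomials there are 1 before and after raising the other exponent.\<close>

lemma mbinom_Suc_0:
  assumes "j \<in> {1..n}"
  shows "a j = 0 \<Longrightarrow> mbinom n a (b(j := Suc (b j))) = (mbinom n a b :: 'a::field)"
    and "b j = 0 \<Longrightarrow> mbinom n (a(j := Suc (a j))) b = (mbinom n a b :: 'a::field)"
proof -
  have "(\<Prod>i\<in>{1..n} - {j}. of_nat (((a(j := x)) i + (b(j := y)) i) choose (a(j := x)) i)) =
      (\<Prod>i\<in>{1..n} - {j}. of_nat ((a i + b i) choose a i) :: 'a)" for x y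
    by (rule prod.cong) auto
  from this[of "a j" "Suc (b j)"] this[of "Suc (a j)" "b j"]
  show "a j = 0 \<Longrightarrow> mbinom n a (b(j := Suc (b j))) = (mbinom n a b :: 'a::field)"
    and "b j = 0 \<Longrightarrow> mbinom n (a(j := Suc (a j))) b = (mbinom n a b :: 'a::field)"
    by (simp_all add: mbinom_split[OF assms])
qed

text \<open>By absorption p^r divides k times the binomial. Were the binomial coprime to p, then p^r
  would divide k, which is too small. This will kill products whose exponent overflows exactly to
  p^r.\<close>

lemma prime_dvd_choose_power:
  assumes "prime p" "0 < k" "k < p ^ r"
  shows "p dvd (p ^ r choose k)"
proof (rule ccontr)
  assume "\<not> p dvd (p ^ r choose k)"
  then have "coprime (p ^ r) (p ^ r choose k)"
    using assms(1) by (simp add: prime_imp_coprime)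
  moreover have "p ^ r dvd k * (p ^ r choose k)"
    using times_binomial_minus1_eq[OF assms(2), of "p ^ r"] by simp
  ultimately have "p ^ r dvd k" by (simp add: coprime_dvd_mult_left_iff)
  then show False using assms by (simp add: nat_dvd_not_less)
qed

section \<open>Ring laws of the divided power algebra\<close>

lemma multi_indices_mono:
  assumes "a \<in> multi_indices p n m" "b \<le> a"
  shows "b \<in> multi_indices p n m"
  unfolding multi_indices_def
proof (intro CollectI conjI ballI allI impI)
  have b: "b i \<le> a i" for i using assms(2) by (simp add: le_fun_def)
  show "b i \<le> p ^ m i - 1" if "i \<in> {1..n}" for i
    using b[of i] assms(1) that unfolding multi_indices_def by force
  show "b i = 0" if "i \<notin> {1..n}" for i
    using b[of i] assms(1) that unfolding multi_indices_def by auto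
qed

lemma finite_splits: "finite {(a, b). a + b = (c :: nat \<Rightarrow> nat)}" if "c \<in> multi_indices p n m"
proof (rule finite_subset)
  have "a \<in> multi_indices p n m" if "a \<le> c" for a
    using multi_indices_mono \<open>c \<in> _\<close> that by blast
  then show "{(a, b). a + b = c} \<subseteq> multi_indices p n m \<times> multi_indices p n m"
    by (auto simp: le_fun_def)
qed (simp add: finite_multi_indices)

lemma dp_mult_apply:
  assumes "c \<in> multi_indices CHAR('a) n m"
  shows "dp_mult n m f g c = (\<Sum>(a, b) | a + b = c. mbinom n a b * f a * (g b :: 'a::field))"
proof -
  have "{(a, b) \<in> multi_indices CHAR('a) n m \<times> multi_indices CHAR('a) n m. a + b = c} =
      {(a, b). a + b = c}"
    by (auto intro: multi_indices_mono[OF assms] simp: le_fun_def)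
  with assms show ?thesis by (simp add: dp_mult_def mbinom_def)
qed

lemma dp_mult_outside: "c \<notin> multi_indices CHAR('a) n m \<Longrightarrow> dp_mult n m f g c = (0 :: 'a::field)"
  by (simp add: dp_mult_def)

lemma dp_mult_commute: "dp_mult n m f g = dp_mult n m g (f :: 'a::field dp)"
proof
  fix c
  show "dp_mult n m f g c = dp_mult n m g f c"
  proof (cases "c \<in> multi_indices CHAR('a) n m")
    case True
    show ?thesis unfolding dp_mult_apply[OF True]
      by (rule sum.reindex_bij_witness[where i = "\<lambda>(a, b). (b, a)" and j = "\<lambda>(a, b). (b, a)"])
        (auto simp: add.commute mbinom_commute)
  qed (simp add: dp_mult_outside)
qed

text \<open>Both sides are sums over triples with total \<open>c\<close>; truncation loses no term
  because partial sums of an admissible index are admissible.\<close>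

lemma dp_mult_assoc:
  "dp_mult n m (dp_mult n m f g) h = dp_mult n m f (dp_mult n m g (h :: 'a::field dp))"
proof
  fix c
  show "dp_mult n m (dp_mult n m f g) h c = dp_mult n m f (dp_mult n m g h) c"
  proof (cases "c \<in> multi_indices CHAR('a) n m")
    case True
    let ?I = "multi_indices CHAR('a) n m" and ?P = "\<lambda>c. {(a, b). a + b = (c :: nat \<Rightarrow> nat)}"
    have mem: "d \<in> ?I" "e \<in> ?I" if "(d, e) \<in> ?P c" for d e
      using that True by (auto intro: multi_indices_mono simp: le_fun_def)
    have fin: "finite (?P c)" if "c \<in> ?I" for c using finite_splits[OF that] .
    have "dp_mult n m (dp_mult n m f g) h c =
        (\<Sum>q\<in>?P c. \<Sum>r\<in>?P (fst q).
          mbinom n (fst q) (snd q) * mbinom n (fst r) (snd r) * f (fst r) * g (snd r) * h (snd q))"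
      unfolding dp_mult_apply[OF True]
      by (rule sum.cong)
        (auto simp: dp_mult_apply mem sum_distrib_left sum_distrib_right mult_ac split_def
          intro!: sum.cong)
    also have "\<dots> = (\<Sum>(q, r)\<in>Sigma (?P c) (\<lambda>q. ?P (fst q)).
          mbinom n (fst q) (snd q) * mbinom n (fst r) (snd r) * f (fst r) * g (snd r) * h (snd q))"
      by (rule sum.Sigma) (use True mem in \<open>auto intro!: fin\<close>)
    \<comment> \<open>The splitting (a + b) + e is regrouped as a + (b + e), and
      \<open>mbinom_assoc\<close> matches the coefficients.\<close>
    also have "\<dots> = (\<Sum>(q, r)\<in>Sigma (?P c) (\<lambda>q. ?P (snd q)).
          mbinom n (fst q) (snd q) * mbinom n (fst r) (snd r) * f (fst q) * g (fst r) * h (snd r))"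
      by (rule sum.reindex_bij_witness[where
            j = "\<lambda>((d, e), (a, b)). ((a, b + e), (b, e))" and
            i = "\<lambda>((a, d), (b, e)). ((a + b, e), (a, b))"])
        (auto simp: add.assoc mbinom_assoc[simplified] mult.assoc[symmetric])
    also have "\<dots> = (\<Sum>q\<in>?P c. \<Sum>r\<in>?P (snd q).
          mbinom n (fst q) (snd q) * mbinom n (fst r) (snd r) * f (fst q) * g (fst r) * h (snd r))"
      by (rule sum.Sigma[symmetric]) (use True mem in \<open>auto intro!: fin\<close>)
    also have "\<dots> = dp_mult n m f (dp_mult n m g h) c"
      unfolding dp_mult_apply[OF True]
      by (rule sum.cong)
        (auto simp: dp_mult_apply mem sum_distrib_left sum_distrib_right mult_ac split_def
          intro!: sum.cong)
    finally show ?thesis .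
  qed (simp add: dp_mult_outside)
qed

lemma dp_mult_add_left: "dp_mult n m (f + g) h = dp_mult n m f h + dp_mult n m g (h :: 'a::field dp)"
  by (auto simp: dp_mult_def fun_eq_iff split_def algebra_simps sum.distrib)

lemma dp_mult_scale_left:
  "dp_mult n m (\<lambda>a. k * f a) h = (\<lambda>a. k * dp_mult n m f (h :: 'a::field dp) a)"
  by (auto simp: dp_mult_def fun_eq_iff split_def mult_ac sum_distrib_left)

lemma dp_mult_add_right: "dp_mult n m h (f + g) = dp_mult n m h f + dp_mult n m h (g :: 'a::field dp)"
  by (metis dp_mult_add_left dp_mult_commute)

lemma dp_mult_scale_right:
  "dp_mult n m h (\<lambda>a. k * f a) = (\<lambda>a. k * dp_mult n m h (f :: 'a::field dp) a)"
  by (metis dp_mult_scale_left dp_mult_commute)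

lemma dp_mult_zero_left [simp]: "dp_mult n m 0 (h :: 'a::field dp) = 0"
  by (auto simp: dp_mult_def fun_eq_iff split_def)

lemma dp_mult_zero_right [simp]: "dp_mult n m (h :: 'a::field dp) 0 = 0"
  by (auto simp: dp_mult_def fun_eq_iff split_def)

lemma dp_mult_minus_left: "dp_mult n m (- f) h = - dp_mult n m f (h :: 'a::field dp)"
  by (auto simp: dp_mult_def fun_eq_iff split_def sum_negf)

lemma dp_mult_minus_right: "dp_mult n m h (- f) = - dp_mult n m h (f :: 'a::field dp)"
  by (metis dp_mult_minus_left dp_mult_commute)

lemma dp_mult_diff_left: "dp_mult n m (f - g) h = dp_mult n m f h - dp_mult n m g (h :: 'a::field dp)"
  using dp_mult_add_left[of n m f "- g" h] by (simp add: dp_mult_minus_left)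

lemma dp_mult_diff_right: "dp_mult n m h (f - g) = dp_mult n m h f - dp_mult n m h (g :: 'a::field dp)"
  by (metis dp_mult_diff_left dp_mult_commute)

lemma dp_mult_sum_left:
  "dp_mult n m (\<Sum>i\<in>A. f i) h = (\<Sum>i\<in>A. dp_mult n m (f i) (h :: 'a::field dp))"
  using sum_comp_morphism[of "\<lambda>g. dp_mult n m g h" f A] by (simp add: dp_mult_add_left o_def)

lemma dp_mult_sum_right:
  "dp_mult n m h (\<Sum>i\<in>A. f i) = (\<Sum>i\<in>A. dp_mult n m h (f i :: 'a::field dp))"
  using sum_comp_morphism[of "dp_mult n m h" f A] by (simp add: dp_mult_add_right o_def)

lemma dp_mult_one:
  assumes "f \<in> dp_carrier n m"
  shows "dp_mult n m (dp_monom 0) f = (f :: 'a::field dp)"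
proof
  fix c
  show "dp_mult n m (dp_monom 0) f c = f c"
  proof (cases "c \<in> multi_indices CHAR('a) n m")
    case True
    have "dp_mult n m (dp_monom 0) f c =
        (\<Sum>q | fst q + snd q = c. if q = (0, c) then f c else 0)"
      unfolding dp_mult_apply[OF True] split_def
      by (rule sum.cong) (auto simp: dp_monom_def mbinom_def)
    also have "\<dots> = f c"
      using finite_splits[OF True] by (simp add: split_def)
    finally show ?thesis .
  qed (use assms in \<open>auto simp: dp_mult_outside dp_carrier_def\<close>)
qed

lemma dp_mult_closed [simp]: "dp_mult n m f g \<in> dp_carrier n m"
  unfolding dp_carrier_def using dp_mult_outside by blast

lemma dp_carrier_zero [simp]: "0 \<in> dp_carrier n m"
  and dp_carrier_add: "f \<in> dp_carrier n m \<Longrightarrow> g \<in> dp_carrier n m \<Longrightarrow> f + g \<in> dp_carrier n m"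
  and dp_carrier_minus: "f \<in> dp_carrier n m \<Longrightarrow> - f \<in> dp_carrier n m"
  and dp_carrier_diff: "f \<in> dp_carrier n m \<Longrightarrow> g \<in> dp_carrier n m \<Longrightarrow> f - g \<in> dp_carrier n m"
  and dp_carrier_scale: "f \<in> dp_carrier n m \<Longrightarrow> (\<lambda>a. k * f a) \<in> dp_carrier n m"
  by (auto simp: dp_carrier_def) (metis add.right_neutral, metis)

lemma dp_carrier_sum:
  "(\<And>i. i \<in> A \<Longrightarrow> f i \<in> dp_carrier n m) \<Longrightarrow> (\<Sum>i\<in>A. f i) \<in> dp_carrier n m"
  by (induction A rule: infinite_finite_induct) (simp_all add: dp_carrier_add)

section \<open>Partial derivatives and the product rule\<close>

lemma dp_deriv_closed:
  assumes "f \<in> dp_carrier n m"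
  shows "dp_deriv j f \<in> (dp_carrier n m :: 'a::field dp set)"
  unfolding dp_carrier_def
proof (intro CollectI allI impI)
  fix a assume "dp_deriv j f a \<noteq> 0"
  then have "a(j := Suc (a j)) \<in> multi_indices CHAR('a) n m"
    using assms by (simp add: dp_deriv_def dp_carrier_def)
  then show "a \<in> multi_indices CHAR('a) n m"
    by (rule multi_indices_mono) (simp add: le_fun_def)
qed

lemma dp_deriv_zero [simp]: "dp_deriv j 0 = 0"
  and dp_deriv_add: "dp_deriv j (f + g) = dp_deriv j f + dp_deriv j (g :: 'a::field dp)"
  and dp_deriv_diff: "dp_deriv j (f - g) = dp_deriv j f - dp_deriv j (g :: 'a::field dp)"
  and dp_deriv_minus: "dp_deriv j (- f) = - dp_deriv j (f :: 'a::field dp)"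
  and dp_deriv_scale: "dp_deriv j (\<lambda>a. k * f a) = (\<lambda>a. k * dp_deriv j (f :: 'a::field dp) a)"
  by (auto simp: dp_deriv_def fun_eq_iff)

lemma dp_deriv_sum: "dp_deriv j (\<Sum>i\<in>A. f i) = (\<Sum>i\<in>A. dp_deriv j (f i :: 'a::field dp))"
  using sum_comp_morphism[of "dp_deriv j" f A] by (simp add: dp_deriv_add o_def)

lemma dp_deriv_commute: "dp_deriv i (dp_deriv j f) = dp_deriv j (dp_deriv i f)"
  by (cases "i = j") (auto simp: dp_deriv_def fun_eq_iff fun_upd_twist)

text \<open>Both terms on the right become sums over the splittings of c + e_j, where Pascal's rule
  adds their coefficients. If c + e_j leaves the index set, the left side is zero by truncation and
  the sum on the right vanishes modulo the characteristic.\<close>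

lemma dp_deriv_mult:
  fixes f g :: "'a::field dp"
  assumes p: "prime CHAR('a)" and j: "j \<in> {1..n}"
    and f: "f \<in> dp_carrier n m" and g: "g \<in> dp_carrier n m"
  shows "dp_deriv j (dp_mult n m f g) =
    dp_mult n m (dp_deriv j f) g + dp_mult n m f (dp_deriv j g)"
proof
  fix c
  let ?I = "multi_indices CHAR('a) n m"
  let ?s = "\<lambda>a :: nat \<Rightarrow> nat. a(j := Suc (a j))"
  show "dp_deriv j (dp_mult n m f g) c =
    (dp_mult n m (dp_deriv j f) g + dp_mult n m f (dp_deriv j g)) c"
  proof (cases "c \<in> ?I")
    case False
    then have "?s c \<notin> ?I" using multi_indices_mono[of "?s c" _ n m c] by (auto simp: le_fun_def)
    with False show ?thesis by (simp add: dp_mult_outside dp_deriv_def)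
  next
    case True
    let ?P = "{q. fst q + snd q = c}" and ?Q = "{q. fst q + snd q = ?s c}"
    have finP: "finite ?P" using finite_splits[OF True] by (simp add: split_def)
    \<comment> \<open>\<open>?L\<close> and \<open>?R\<close> are the splittings of c + e_j obtained
      from a splitting of c by raising the first or the second part.\<close>
    let ?L = "{q \<in> ?Q. fst q j > 0}" and ?R = "{q \<in> ?Q. snd q j > 0}"
    let ?d = "\<lambda>a :: nat \<Rightarrow> nat. a(j := a j - 1)"
    have L: "?L = (\<lambda>q. (?s (fst q), snd q)) ` ?P"
    proof (rule set_eqI, rule iffI)
      fix q assume "q \<in> ?L"
      then have q: "fst q + snd q = ?s c" "fst q j > 0" by auto
      have "(?d (fst q) + snd q) i = c i" for i
        using fun_cong[OF q(1), of i] q(2) by (cases "i = j") auto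
      then have 1: "(?d (fst q), snd q) \<in> ?P" by (auto simp: fun_eq_iff)
      have "q = (?s (?d (fst q)), snd q)" using q(2) by (auto simp: prod_eq_iff)
      then show "q \<in> (\<lambda>q. (?s (fst q), snd q)) ` ?P"
        by (intro image_eqI[OF _ 1]) (simp only: fst_conv snd_conv)
    qed (auto simp: fun_eq_iff)
    have R: "?R = (\<lambda>q. (fst q, ?s (snd q))) ` ?P"
    proof (rule set_eqI, rule iffI)
      fix q assume "q \<in> ?R"
      then have q: "fst q + snd q = ?s c" "snd q j > 0" by auto
      have "(fst q + ?d (snd q)) i = c i" for i
        using fun_cong[OF q(1), of i] q(2) by (cases "i = j") auto
      then have 1: "(fst q, ?d (snd q)) \<in> ?P" by (auto simp: fun_eq_iff)
      have "q = (fst q, ?s (?d (snd q)))" using q(2) by (auto simp: prod_eq_iff)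
      then show "q \<in> (\<lambda>q. (fst q, ?s (snd q))) ` ?P"
        by (intro image_eqI[OF _ 1]) (simp only: fst_conv snd_conv)
    qed (auto simp: fun_eq_iff)
    have Qj: "fst q j + snd q j = Suc (c j)" if "q \<in> ?Q" for q
      using fun_cong[OF CollectD[OF that], of j] by simp
    have pos: "fst q j > 0 \<or> snd q j > 0" if "q \<in> ?Q" for q
      using Qj[OF that] by linarith
    then have Q: "?Q = ?L \<union> ?R" by blast
    have finQ: "finite ?Q"
      by (subst Q) (simp only: L R finite_Un finite_imageI[OF finP] simp_thms)
    have sinj: "inj ?s" by (rule injI) (metis fun_upd_same fun_upd_triv fun_upd_upd nat.inject)
    let ?x = "\<lambda>q. f (fst q) * g (snd q)"
    have "dp_mult n m (dp_deriv j f) g c =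
        (\<Sum>q\<in>?P. mbinom n (fst q) (snd q) * ?x (?s (fst q), snd q))"
      by (simp add: dp_mult_apply[OF True] split_def dp_deriv_def mult.assoc)
    also have "\<dots> = (\<Sum>q\<in>?L. mbinom n (?d (fst q)) (snd q) * ?x q)"
      unfolding L using sinj by (subst sum.reindex) (auto simp: inj_on_def dest: injD)
    also have "\<dots> = (\<Sum>q\<in>?Q. (if fst q j > 0 then mbinom n (?d (fst q)) (snd q) else 0) * ?x q)"
      by (rule sum.mono_neutral_cong_left) (use finQ in auto)
    finally have 1: "dp_mult n m (dp_deriv j f) g c = \<dots>" .
    have "dp_mult n m f (dp_deriv j g) c =
        (\<Sum>q\<in>?P. mbinom n (fst q) (snd q) * ?x (fst q, ?s (snd q)))"
      by (simp add: dp_mult_apply[OF True] split_def dp_deriv_def mult.assoc)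
    also have "\<dots> = (\<Sum>q\<in>?R. mbinom n (fst q) (?d (snd q)) * ?x q)"
      unfolding R using sinj by (subst sum.reindex) (auto simp: inj_on_def dest: injD)
    also have "\<dots> = (\<Sum>q\<in>?Q. (if snd q j > 0 then mbinom n (fst q) (?d (snd q)) else 0) * ?x q)"
      by (rule sum.mono_neutral_cong_left) (use finQ in auto)
    finally have 2: "dp_mult n m f (dp_deriv j g) c = \<dots>" .
    \<comment> \<open>The entries in coordinate \<open>j\<close> add up to c_j + 1, so they are not
      both zero. If both are positive this is Pascal's rule; otherwise a single summand
      survives.\<close>
    have pascal: "(if fst q j > 0 then mbinom n (?d (fst q)) (snd q) else 0) +
        (if snd q j > 0 then mbinom n (fst q) (?d (snd q)) else 0) =
        (mbinom n (fst q) (snd q) :: 'a)" if "q \<in> ?Q" for q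
    proof -
      obtain a b where q: "q = (a, b)" by (cases q)
      have s: "?s (?d x) = x" if "x j > 0" for x :: "nat \<Rightarrow> nat"
        using that by (auto simp: fun_eq_iff)
      show ?thesis
        using pos[OF that] mbinom_pascal[OF j, of "?d a" "?d b", where ?'a = 'a] s[of a] s[of b]
          mbinom_Suc_0(1)[OF j, of a "?d b", where ?'a = 'a]
          mbinom_Suc_0(2)[OF j, of b "?d a", where ?'a = 'a]
        by (cases "a j > 0"; cases "b j > 0") (auto simp: q)
    qed
    have "dp_mult n m (dp_deriv j f) g c + dp_mult n m f (dp_deriv j g) c =
        (\<Sum>q\<in>?Q. mbinom n (fst q) (snd q) * ?x q)"
      unfolding 1 2 sum.distrib[symmetric] distrib_right[symmetric]
      by (rule sum.cong) (simp_all add: pascal)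
    also have "\<dots> = dp_mult n m f g (?s c)"
    proof (cases "?s c \<in> ?I")
      \<comment> \<open>Overflow forces c_j + 1 = p^(m_j). A splitting with both parts admissible
        has both entries strictly between 0 and p^(m_j), so its binomial vanishes; any other
        splitting meets a zero coefficient of \<open>f\<close> or \<open>g\<close>.\<close>
      case False
      have lt: "a j < CHAR('a) ^ m j" if "a \<in> ?I" for a
      proof -
        have "a j \<le> CHAR('a) ^ m j - 1" using that j by (simp add: multi_indices_def)
        moreover have "CHAR('a) ^ m j > 0" using prime_gt_0_nat[OF p] by simp
        ultimately show ?thesis by linarith
      qed
      have "Suc (c j) > CHAR('a) ^ m j - 1"
        using False True j by (auto simp: multi_indices_def split: if_splits)
      then have cj: "Suc (c j) = CHAR('a) ^ m j" using lt[OF True] by linarith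
      have "mbinom n (fst q) (snd q) * ?x q = 0" if q: "q \<in> ?Q" for q
      proof (cases "fst q \<in> ?I \<and> snd q \<in> ?I")
        case False
        then show ?thesis using f g by (auto simp: dp_carrier_def)
      next
        case True
        have "fst q j + snd q j = CHAR('a) ^ m j"
          using Qj[OF q] cj by simp
        moreover have "fst q j < CHAR('a) ^ m j" "snd q j < CHAR('a) ^ m j"
          using True lt by auto
        ultimately have "of_nat ((fst q j + snd q j) choose fst q j) = (0 :: 'a)"
          using prime_dvd_choose_power[OF p, of "fst q j" "m j"]
          by (simp add: of_nat_eq_0_iff_char_dvd)
        then show ?thesis by (simp add: mbinom_split[OF j])
      qed
      then show ?thesis using False by (auto simp: dp_mult_outside intro!: sum.neutral)
    qed (simp add: dp_mult_apply split_def mult.assoc)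
    finally show ?thesis by (simp add: dp_deriv_def)
  qed
qed

section \<open>The Witt algebra\<close>

text \<open>The derivation with coefficient tuple \<open>u\<close>, applied to \<open>f\<close>. It
  reduces the Jacobi identity to commutators of operators.\<close>

definition witt_action :: "nat \<Rightarrow> (nat \<Rightarrow> nat) \<Rightarrow> 'a::field witt_elem \<Rightarrow> 'a dp \<Rightarrow> 'a dp" where
  "witt_action n m u f = (\<Sum>i=1..n. dp_mult n m (u i) (dp_deriv i f))"

lemma witt_action_add: "witt_action n m u (f + g) = witt_action n m u f + witt_action n m u g"
  and witt_action_diff: "witt_action n m u (f - g) = witt_action n m u f - witt_action n m u g"
  and witt_action_add_left: "witt_action n m (u + v) f = witt_action n m u f + witt_action n m v f"
  and witt_action_scale:
    "witt_action n m u (\<lambda>a. c * f a) = (\<lambda>a. c * witt_action n m u f a)"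
  and witt_action_scale_left:
    "witt_action n m (witt_scale c u) f = (\<lambda>a. c * witt_action n m u f a)"
proof -
  have s: "(\<Sum>i=1..n. (\<lambda>a. c * g i a)) = (\<lambda>a. c * (\<Sum>i=1..n. g i) a)" for c and g :: "nat \<Rightarrow> 'a dp"
    by (induction n) (simp_all add: fun_eq_iff algebra_simps)
  show "witt_action n m u (f + g) = witt_action n m u f + witt_action n m u g"
    "witt_action n m u (f - g) = witt_action n m u f - witt_action n m u g"
    "witt_action n m (u + v) f = witt_action n m u f + witt_action n m v f"
    unfolding witt_action_def
    by (simp_all only: dp_deriv_add dp_deriv_diff dp_mult_add_right dp_mult_diff_right
        dp_mult_add_left sum.distrib sum_subtractf plus_fun_apply)
  show "witt_action n m u (\<lambda>a. c * f a) = (\<lambda>a. c * witt_action n m u f a)"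
    unfolding witt_action_def by (simp only: dp_deriv_scale dp_mult_scale_right s)
  show "witt_action n m (witt_scale c u) f = (\<lambda>a. c * witt_action n m u f a)"
    unfolding witt_action_def witt_scale_def by (simp only: dp_mult_scale_left s)
qed

lemma witt_bracket_action:
  "witt_bracket n m u v k = witt_action n m u (v k) - witt_action n m v (u k)"
  by (simp only: witt_bracket_def witt_action_def sum_subtractf)

lemma carrier_witt:
  "lcarrier (witt n m) = {u. (\<forall>j\<in>{1..n}. u j \<in> dp_carrier n m) \<and> (\<forall>j. j \<notin> {1..n} \<longrightarrow> u j = 0)}"
  and witt_sel [simp]: "ladd (witt n m) = (+)" "lzero (witt n m) = 0"
    "lscale (witt n m) = witt_scale" "lbracket (witt n m) = witt_bracket n m"
  by (simp_all add: witt_def)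

lemma carrier_wittD: "u \<in> lcarrier (witt n m) \<Longrightarrow> u j \<in> dp_carrier n m"
  by (cases "j \<in> {1..n}") (auto simp: carrier_witt)

lemma witt_action_closed: "witt_action n m u f \<in> dp_carrier n m"
  unfolding witt_action_def by (intro dp_carrier_sum dp_mult_closed)

lemma witt_bracket_closed:
  assumes "u \<in> lcarrier (witt n m)" "v \<in> lcarrier (witt n m)"
  shows "witt_bracket n m u v \<in> lcarrier (witt n m)"
proof -
  have "witt_action n m w 0 = 0" for w :: "'a witt_elem"
    using witt_action_diff[of n m w 0 0] by simp
  with assms show ?thesis
    by (auto simp: carrier_witt witt_bracket_action dp_carrier_diff witt_action_closed)
qed

text \<open>The second-order parts \<open>?T\<close> of the two compositions agree, since products
  and partial derivatives commute, and cancel; the first-order parts make up the action of the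
  bracket.\<close>

lemma witt_action_bracket:
  fixes f :: "'a::field dp"
  assumes p: "prime CHAR('a)" and u: "u \<in> lcarrier (witt n m)" and v: "v \<in> lcarrier (witt n m)"
    and f: "f \<in> dp_carrier n m"
  shows "witt_action n m (witt_bracket n m u v) f =
    witt_action n m u (witt_action n m v f) - witt_action n m v (witt_action n m u f)"
proof -
  let ?T = "\<lambda>u v. \<Sum>i=1..n. \<Sum>k=1..n.
      dp_mult n m (dp_mult n m (u i) (v k)) (dp_deriv i (dp_deriv k f))"
  have comp: "witt_action n m u (witt_action n m v f) =
      (\<Sum>k=1..n. dp_mult n m (witt_action n m u (v k)) (dp_deriv k f)) + ?T u v"
    if "v \<in> lcarrier (witt n m)" for u v :: "'a witt_elem"
  proof -
    have "witt_action n m u (witt_action n m v f) = (\<Sum>i=1..n. \<Sum>k=1..n.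
        dp_mult n m (u i) (dp_mult n m (dp_deriv i (v k)) (dp_deriv k f)) +
        dp_mult n m (u i) (dp_mult n m (v k) (dp_deriv i (dp_deriv k f))))"
      unfolding witt_action_def dp_deriv_sum dp_mult_sum_right
      by (intro sum.cong refl)
        (simp only: dp_deriv_mult[OF p _ carrier_wittD[OF that] dp_deriv_closed[OF f]] dp_mult_add_right)
    also have "\<dots> = (\<Sum>i=1..n. \<Sum>k=1..n.
        dp_mult n m (dp_mult n m (u i) (dp_deriv i (v k))) (dp_deriv k f)) + ?T u v"
      by (simp only: sum.distrib dp_mult_assoc)
    also have "(\<Sum>i=1..n. \<Sum>k=1..n.
        dp_mult n m (dp_mult n m (u i) (dp_deriv i (v k))) (dp_deriv k f)) =
        (\<Sum>k=1..n. dp_mult n m (witt_action n m u (v k)) (dp_deriv k f))"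
      unfolding witt_action_def dp_mult_sum_left by (rule sum.swap)
    finally show ?thesis .
  qed
  have T: "?T u v = ?T v u"
    by (subst sum.swap) (simp only: dp_mult_commute[of n m "u _" "v _"] dp_deriv_commute)
  have "witt_action n m (witt_bracket n m u v) f =
      (\<Sum>k=1..n. dp_mult n m (witt_action n m u (v k)) (dp_deriv k f)) -
      (\<Sum>k=1..n. dp_mult n m (witt_action n m v (u k)) (dp_deriv k f))"
    unfolding witt_action_def[of n m "witt_bracket n m u v"] witt_bracket_action
    by (simp only: dp_mult_diff_left sum_subtractf)
  then show ?thesis using comp[OF u] comp[OF v] T by simp
qed

text \<open>In component \<open>k\<close> each outer bracket is an action on an inner bracket minus
  the action of that inner bracket. Writing the latter as a commutator leaves double actions that
  cancel in pairs.\<close>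

lemma witt_jacobi:
  fixes u v w :: "'a::field witt_elem"
  assumes "prime CHAR('a)" and "u \<in> lcarrier (witt n m)" "v \<in> lcarrier (witt n m)"
    "w \<in> lcarrier (witt n m)"
  shows "witt_bracket n m u (witt_bracket n m v w) +
    (witt_bracket n m v (witt_bracket n m w u) + witt_bracket n m w (witt_bracket n m u v)) = 0"
proof
  fix k
  show "(witt_bracket n m u (witt_bracket n m v w) +
    (witt_bracket n m v (witt_bracket n m w u) + witt_bracket n m w (witt_bracket n m u v))) k = 0 k"
    by (simp only: plus_fun_apply zero_fun_apply witt_bracket_action[of n m u "witt_bracket n m v w"]
        witt_bracket_action[of n m v "witt_bracket n m w u"]
        witt_bracket_action[of n m w "witt_bracket n m u v"]
        witt_action_bracket[OF assms(1) assms(2) assms(3) carrier_wittD[OF assms(4)]]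
        witt_action_bracket[OF assms(1) assms(3) assms(4) carrier_wittD[OF assms(2)]]
        witt_action_bracket[OF assms(1) assms(4) assms(2) carrier_wittD[OF assms(3)]])
      (simp add: witt_bracket_action witt_action_diff)
qed

lemma witt_bracket_add_left: "witt_bracket n m (u + v) w = witt_bracket n m u w + witt_bracket n m v w"
  and witt_bracket_add_right: "witt_bracket n m w (u + v) = witt_bracket n m w u + witt_bracket n m w v"
  and witt_bracket_scale_left: "witt_bracket n m (witt_scale c u) w = witt_scale c (witt_bracket n m u w)"
  and witt_bracket_scale_right: "witt_bracket n m w (witt_scale c u) = witt_scale c (witt_bracket n m w u)"
  and witt_bracket_self: "witt_bracket n m u u = 0"
proof -
  have s: "witt_scale c x k = (\<lambda>a. c * x k a)" for x :: "'a witt_elem" and k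
    by (simp add: witt_scale_def)
  show "witt_bracket n m (u + v) w = witt_bracket n m u w + witt_bracket n m v w"
    "witt_bracket n m w (u + v) = witt_bracket n m w u + witt_bracket n m w v"
    "witt_bracket n m u u = 0"
    by (rule ext, simp add: witt_bracket_action witt_action_add witt_action_add_left)+
  show "witt_bracket n m (witt_scale c u) w = witt_scale c (witt_bracket n m u w)"
    "witt_bracket n m w (witt_scale c u) = witt_scale c (witt_bracket n m w u)"
    by (rule ext, simp add: s witt_bracket_action witt_action_scale witt_action_scale_left,
        simp add: fun_eq_iff algebra_simps)+
qed

lemma lie_algebra_witt:
  assumes "prime CHAR('a::field)"
  shows "lie_algebra (witt n m :: ('a, 'a witt_elem) lie_structure)"
proof unfold_locales
  fix x :: "'a witt_elem"
  assume "x \<in> lcarrier (witt n m)"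
  then have "- x \<in> lcarrier (witt n m)" by (auto simp: carrier_witt dp_carrier_minus)
  then show "\<exists>y\<in>lcarrier (witt n m). ladd (witt n m) x y = lzero (witt n m)"
    by (intro bexI[of _ "- x"]) simp_all
next
  fix x :: "'a witt_elem" and c
  assume x: "x \<in> lcarrier (witt n m)"
  then show "lscale (witt n m) c x \<in> lcarrier (witt n m)"
    by (auto simp: carrier_witt witt_scale_def dp_carrier_scale zero_fun_def)
qed (simp_all add: witt_bracket_closed witt_bracket_add_left witt_bracket_add_right
    witt_bracket_scale_left witt_bracket_scale_right witt_bracket_self witt_jacobi[OF assms],
    auto simp: carrier_witt dp_carrier_add witt_scale_def fun_eq_iff algebra_simps)

section \<open>Hamiltonian form of the special algebra in two variables\<close>

definition ham :: "'a::field dp \<Rightarrow> 'a witt_elem" where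
  "ham f = (\<lambda>k. if k = 1 then dp_deriv 2 f else if k = 2 then - dp_deriv 1 f else 0)"

definition idx :: "nat \<Rightarrow> nat \<Rightarrow> nat \<Rightarrow> nat" where
  "idx i j = (\<lambda>k. if k = 1 then i else if k = 2 then j else 0)"

abbreviation mon2 :: "nat \<Rightarrow> nat \<Rightarrow> 'a::field dp" where
  "mon2 i j \<equiv> dp_monom (idx i j)"

lemma idx_sel [simp]: "idx i j (Suc 0) = i" "idx i j 2 = j" "idx i j 0 = 0"
  by (simp_all add: idx_def)

lemma idx_upd [simp]: "(idx i j)(Suc 0 := k) = idx k j" "(idx i j)(2 := k) = idx i k"
  by (auto simp: idx_def)

lemma idx_add: "idx i j + idx k l = idx (i + k) (j + l)"
  by (auto simp: idx_def)

lemma idx_eq_iff [simp]: "idx i j = idx k l \<longleftrightarrow> i = k \<and> j = l"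
  by (metis idx_sel(1,2))

lemma ham_sel [simp]: "ham f (Suc 0) = dp_deriv 2 f" "ham f 2 = - dp_deriv 1 f"
  by (simp_all add: ham_def)

lemma ham_add: "ham (f + g) = ham f + ham g"
  and ham_diff: "ham (f - g) = ham f - ham g"
  and ham_zero [simp]: "ham 0 = 0"
  and ham_scale: "ham (\<lambda>a. c * f a) = witt_scale c (ham f)"
  by (auto simp: ham_def witt_scale_def dp_deriv_def fun_eq_iff)

lemma sum_1_2: "(\<Sum>i = 1..2::nat. f i) = f 1 + (f 2 :: 'b::comm_monoid_add)"
  by (simp add: numeral_2_eq_2)

lemma prod_1_2: "(\<Prod>i = 1..2::nat. f i) = f 1 * (f 2 :: 'b::comm_monoid_mult)"
  by (simp add: numeral_2_eq_2)

lemma atLeastAtMost_1_2: "j \<in> {1..2::nat} \<longleftrightarrow> j = 1 \<or> j = 2"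
  by auto

lemma witt_div_2: "witt_div 2 u = dp_deriv 1 (u 1) + dp_deriv 2 (u 2)"
  unfolding witt_div_def by (rule sum_1_2)

lemma ham_closed: "f \<in> dp_carrier 2 m \<Longrightarrow> ham f \<in> lcarrier (witt 2 m)"
  by (auto simp: carrier_witt ham_def dp_deriv_closed dp_carrier_minus)

lemma witt_div_ham: "witt_div 2 (ham f) = 0"
  using dp_deriv_commute[of 1 2 f] by (simp add: witt_div_2 dp_deriv_minus)

lemma dp_deriv_mon2:
  "dp_deriv 1 (mon2 i j :: 'a::field dp) = (if 1 \<le> i then mon2 (i - 1) j else 0)"
  "dp_deriv 2 (mon2 i j :: 'a::field dp) = (if 1 \<le> j then mon2 i (j - 1) else 0)"
  by (simp_all add: dp_deriv_monom)

lemma lie_subspace_update: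
  "lie_subspace (L\<lparr>lcarrier := C\<rparr>) U \<longleftrightarrow> U \<subseteq> C \<and> lzero L \<in> U \<and>
     (\<forall>x\<in>U. \<forall>y\<in>U. ladd L x y \<in> U) \<and> (\<forall>c. \<forall>x\<in>U. lscale L c x \<in> U)"
  by (simp add: lie_subspace_def)

text \<open>\<open>f\<close> has finite support, so \<open>ham f\<close> is a finite linear
  combination of fields of monomials. Asking only for monomials in the support lets this serve
  potentials with and without a top monomial.\<close>

lemma ham_monom_span:
  assumes U: "lie_subspace ((witt n m)\<lparr>lcarrier := C\<rparr>) U"
    and f: "f \<in> (dp_carrier k m' :: 'a::field dp set)"
    and mono: "\<And>a. f a \<noteq> 0 \<Longrightarrow> ham (dp_monom a) \<in> U"
  shows "ham f \<in> U"
proof -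
  let ?r = "\<lambda>F b. if b \<in> F then f b else 0"
  have "ham (?r F) \<in> U" if "finite F" for F
    using that
  proof (induction F rule: finite_induct)
    case empty
    have e: "?r {} = 0" by (simp add: fun_eq_iff)
    have "0 \<in> U" using U by (simp add: lie_subspace_update)
    then show ?case by (simp only: e ham_zero)
  next
    case (insert x F)
    show ?case
    proof (cases "f x = 0")
      case True
      then have "?r (insert x F) = ?r F" by (intro ext) auto
      with insert show ?thesis by simp
    next
      case False
      have "?r (insert x F) = ?r F + (\<lambda>b. f x * dp_monom x b)"
        using insert(2) by (intro ext) (auto simp: dp_monom_def)
      then have "ham (?r (insert x F)) = ham (?r F) + witt_scale (f x) (ham (dp_monom x))"
        by (simp only: ham_add ham_scale)
      moreover have "ham (?r F) + witt_scale (f x) (ham (dp_monom x)) \<in> U"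
        using insert(3) mono[OF False] U by (simp add: lie_subspace_update)
      ultimately show ?thesis by (simp only:)
    qed
  qed
  from this[OF finite_multi_indices[of "CHAR('a)" k m']]
  have "ham (?r (multi_indices CHAR('a) k m')) \<in> U" .
  moreover have "?r (multi_indices CHAR('a) k m') = f"
    using f by (auto simp: dp_carrier_def fun_eq_iff)
  ultimately show ?thesis by simp
qed

lemma witt_bracket_skew: "witt_bracket n m u v = - witt_bracket n m v u"
  by (rule ext) (simp add: witt_bracket_action)

text \<open>The parameter \<open>ty\<close> fixes the field, which does not occur in
  \<open>m\<close>. The argument runs in prime characteristic; the later case \<open>t1 = 1\<close>
  forces characteristic 2 and \<open>m 1 = 1\<close>.\<close>

locale special_two =
  fixes m :: "nat \<Rightarrow> nat" and ty :: "'a::field itself"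
  assumes prime: "prime CHAR('a)" and m_pos: "m 1 > 0" "m 2 > 0"
begin

abbreviation A :: "'a dp set" where "A \<equiv> dp_carrier 2 m"
abbreviation mul :: "'a dp \<Rightarrow> 'a dp \<Rightarrow> 'a dp" where "mul \<equiv> dp_mult 2 m"
abbreviation br :: "'a witt_elem \<Rightarrow> 'a witt_elem \<Rightarrow> 'a witt_elem" where "br \<equiv> witt_bracket 2 m"
abbreviation W :: "('a, 'a witt_elem) lie_structure" where "W \<equiv> witt 2 m"

definition t1 :: nat where "t1 = CHAR('a) ^ m 1 - 1"
definition t2 :: nat where "t2 = CHAR('a) ^ m 2 - 1"

abbreviation B :: "'a dp set" where "B \<equiv> {f \<in> A. f (idx t1 t2) = 0}"

lemma t_pos: "t1 > 0" "t2 > 0"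
proof -
  have "CHAR('a) ^ k > 1" if "k > 0" for k
    using one_less_power[OF prime_gt_1_nat[OF prime] that] .
  then show "t1 > 0" "t2 > 0" using m_pos by (simp_all add: t1_def t2_def)
qed

lemma multi_indices_iff:
  "a \<in> multi_indices CHAR('a) 2 m \<longleftrightarrow> (\<exists>i j. a = idx i j \<and> i \<le> t1 \<and> j \<le> t2)"
proof
  assume a: "a \<in> multi_indices CHAR('a) 2 m"
  then have "a k = 0" if "k \<noteq> 1" "k \<noteq> 2" for k
    using that unfolding multi_indices_def atLeastAtMost_1_2 by blast
  then have "a = idx (a 1) (a 2)" by (auto simp: idx_def fun_eq_iff)
  moreover have "a 1 \<le> t1" "a 2 \<le> t2" using a by (auto simp: multi_indices_def t1_def t2_def)
  ultimately show "\<exists>i j. a = idx i j \<and> i \<le> t1 \<and> j \<le> t2" by blast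
next
  assume "\<exists>i j. a = idx i j \<and> i \<le> t1 \<and> j \<le> t2"
  then show "a \<in> multi_indices CHAR('a) 2 m"
    unfolding multi_indices_def Ball_def atLeastAtMost_1_2 by (auto simp: t1_def t2_def idx_def)
qed

lemma idx_mem [simp]: "idx i j \<in> multi_indices CHAR('a) 2 m \<longleftrightarrow> i \<le> t1 \<and> j \<le> t2"
  by (auto simp: multi_indices_iff)

lemma mon2_closed: "i \<le> t1 \<Longrightarrow> j \<le> t2 \<Longrightarrow> mon2 i j \<in> A"
  by (intro dp_monom_closed) simp

lemma mon2_in_B: "i \<le> t1 \<Longrightarrow> j \<le> t2 \<Longrightarrow> i < t1 \<or> j < t2 \<Longrightarrow> mon2 i j \<in> B"
  using mon2_closed by (auto simp: dp_monom_def)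

lemma mul_mon2:
  assumes "i + k \<le> t1" "j + l \<le> t2"
  shows "mul (mon2 i j) (mon2 k l) =
    (\<lambda>c. of_nat (((i + k) choose i) * ((j + l) choose j)) * mon2 (i + k) (j + l) c)"
proof -
  have "(\<Prod>q = 1..2. of_nat ((idx i j q + idx k l q) choose idx i j q)) =
      (of_nat (((i + k) choose i) * ((j + l) choose j)) :: 'a)"
    by (simp add: prod_1_2[unfolded One_nat_def])
  then show ?thesis using assms by (subst dp_mult_monom) (simp_all add: idx_add)
qed

lemma mon2_00: "mon2 0 0 = dp_monom 0"
  by (rule arg_cong[of _ _ dp_monom]) (auto simp: idx_def)

lemma mul_one: "f \<in> A \<Longrightarrow> mul (mon2 0 0) f = f"
  by (simp add: mon2_00 dp_mult_one)

lemma A_outside: "f \<in> A \<Longrightarrow> i > t1 \<or> j > t2 \<Longrightarrow> f (idx i j) = 0"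
  using idx_mem[of i j] by (auto simp: dp_carrier_def)

text \<open>The top coefficient of a derivative is a coefficient of \<open>f\<close> beyond the
  index set, hence zero.\<close>

lemma deriv_in_B: "f \<in> A \<Longrightarrow> dp_deriv 1 f \<in> B" "f \<in> A \<Longrightarrow> dp_deriv 2 f \<in> B"
  by (auto simp: dp_deriv_closed A_outside, simp_all add: dp_deriv_def A_outside)

text \<open>The product rule applied to the potential gives the bracket once D1 w1 = -D2 w2 is used
  for w = u and w = v. The fields need not be Hamiltonian, which later admits fields whose own
  potential lies outside \<open>A\<close>.\<close>

lemma bracket_div_free:
  assumes u: "u \<in> lcarrier W" "witt_div 2 u = 0" and v: "v \<in> lcarrier W" "witt_div 2 v = 0"
  shows "br u v = ham (mul (u 2) (v 1) - mul (u 1) (v 2))"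
proof -
  note [simp] = carrier_wittD[OF u(1)] carrier_wittD[OF v(1)]
  have d: "dp_deriv 1 (w 1) = - dp_deriv 2 (w 2)" if "witt_div 2 w = 0" for w :: "'a witt_elem"
    using that by (simp add: witt_div_2 eq_neg_iff_add_eq_0)
  have leib: "dp_deriv j (mul f g) = mul (dp_deriv j f) g + mul f (dp_deriv j g)"
    if "f \<in> A" "g \<in> A" "j = 1 \<or> j = 2" for f g j
    using dp_deriv_mult[OF prime, of j 2 f m g] that by auto
  have b: "br u v k = (mul (u 1) (dp_deriv 1 (v k)) - mul (v 1) (dp_deriv 1 (u k))) +
      (mul (u 2) (dp_deriv 2 (v k)) - mul (v 2) (dp_deriv 2 (u k)))" for k
    unfolding witt_bracket_def by (rule sum_1_2)
  have "br u v 1 = ham (mul (u 2) (v 1) - mul (u 1) (v 2)) 1"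
    unfolding b ham_def d[OF u(2)] d[OF v(2)]
    by (simp add: leib dp_deriv_diff dp_mult_minus_right dp_mult_commute[of _ _ "dp_deriv 2 _"]
        del: One_nat_def)
  moreover have "br u v 2 = ham (mul (u 2) (v 1) - mul (u 1) (v 2)) 2"
  proof -
    \<comment> \<open>The second component uses the same relation in the other direction,
      eliminating D2 w2.\<close>
    have d': "dp_deriv 2 (w 2) = - dp_deriv 1 (w 1)" if "witt_div 2 w = 0" for w :: "'a witt_elem"
      using d[OF that] by simp
    show ?thesis
      unfolding b ham_def d'[OF u(2)] d'[OF v(2)]
      by (simp add: leib dp_deriv_diff dp_mult_minus_right dp_mult_commute[of _ _ "dp_deriv 1 _"]
          del: One_nat_def)
  qed
  moreover have "br u v k = ham (mul (u 2) (v 1) - mul (u 1) (v 2)) k" if "k \<noteq> 1" "k \<noteq> 2" for k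
    using witt_bracket_closed[OF u(1) v(1)] that unfolding ham_def
    by (simp add: carrier_witt atLeastAtMost_1_2 del: atLeastAtMost_iff One_nat_def)
  ultimately show ?thesis by (intro ext) metis
qed

lemma bracket_ham:
  assumes "f \<in> A" "g \<in> A"
  shows "br (ham f) (ham g) =
    ham (mul (dp_deriv 2 f) (dp_deriv 1 g) - mul (dp_deriv 1 f) (dp_deriv 2 g))"
  using bracket_div_free[OF ham_closed[OF assms(1)] witt_div_ham ham_closed[OF assms(2)] witt_div_ham]
  by (simp add: dp_mult_minus_left dp_mult_minus_right)

text \<open>\<open>ham (mon2 1 0)\<close> is -D2, so the left side is [D2, ham f], and D2 commutes
  with \<open>ham\<close>.\<close>

lemma bracket_ham_x1:
  assumes "f \<in> A"
  shows "br (ham f) (ham (mon2 1 0)) = ham (dp_deriv 2 f)"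
  using assms t_pos
  by (subst bracket_ham)
    (simp_all add: mon2_closed dp_deriv_mon2[unfolded One_nat_def]
      dp_mult_commute[of _ _ _ "mon2 0 0"] mul_one dp_deriv_closed)

text \<open>\<open>ham (mon2 0 1)\<close> is D1, which commutes with \<open>ham\<close>.\<close>

lemma bracket_x2_ham:
  assumes "f \<in> A"
  shows "br (ham (mon2 0 1)) (ham f) = ham (dp_deriv 1 f)"
  using assms t_pos
  by (subst bracket_ham)
    (simp_all add: mon2_closed dp_deriv_mon2[unfolded One_nat_def] mul_one dp_deriv_closed)

lemma ham_subspace:
  assumes "U = ham ` A \<or> U = ham ` B" and "U \<subseteq> C"
  shows "lie_subspace (W\<lparr>lcarrier := C\<rparr>) U"
proof -
  \<comment> \<open>\<open>P\<close> treats both cases at once: always true for \<open>A\<close>,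
    vanishing top coefficient for \<open>B\<close>.\<close>
  obtain P where U: "U = ham ` {f \<in> A. P f}" and
    P: "P 0" "\<And>f g. P f \<Longrightarrow> P g \<Longrightarrow> P (f + g)" "\<And>c f. P f \<Longrightarrow> P (\<lambda>a. c * f a)"
    using assms(1)
  proof
    assume "U = ham ` A"
    then show thesis by (intro that[of "\<lambda>_. True"]) auto
  next
    assume "U = ham ` B"
    then show thesis by (intro that[of "\<lambda>f. f (idx t1 t2) = 0"]) auto
  qed
  show ?thesis
    unfolding lie_subspace_update witt_sel
  proof (intro conjI ballI allI)
    show "0 \<in> U" unfolding U using P(1) by (intro image_eqI[of _ _ 0]) simp_all
    fix x y assume "x \<in> U" "y \<in> U"
    then obtain f g where "x = ham f" "f \<in> A" "P f" "y = ham g" "g \<in> A" "P g" unfolding U by auto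
    then show "x + y \<in> U"
      unfolding U using P(2) by (intro image_eqI[of _ _ "f + g"]) (simp_all add: ham_add dp_carrier_add)
  next
    fix c x assume "x \<in> U"
    then obtain f where "x = ham f" "f \<in> A" "P f" unfolding U by auto
    then show "witt_scale c x \<in> U"
      unfolding U using P(3)
      by (intro image_eqI[of _ _ "\<lambda>a. c * f a"]) (simp_all add: ham_scale dp_carrier_scale)
  qed (rule assms(2))
qed

lemma mon2_cases:
  assumes "i \<le> t1" "j \<le> t2" "i < t1 \<or> j < t2"
  obtains (first) "i < t1" "mon2 i j = (dp_deriv 1 (mon2 (Suc i) j) :: 'a dp)"
    | (second) "j < t2" "mon2 i j = (dp_deriv 2 (mon2 i (Suc j)) :: 'a dp)"
  using assms(3) by (elim disjE) (auto simp: dp_deriv_mon2 intro: that simp del: One_nat_def)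

text \<open>A monomial other than the top one has an antiderivative monomial in one of the
  variables, and bracketing with D1 or -D2 recovers the derivative.\<close>

lemma ham_mon2_commutator:
  assumes "i \<le> t1" "j \<le> t2" "i < t1 \<or> j < t2"
  shows "\<exists>f\<in>A. \<exists>g\<in>A. ham (mon2 i j) = br (ham f) (ham g)"
  using assms
proof (cases rule: mon2_cases)
  case first
  then show ?thesis
    using bracket_x2_ham[of "mon2 (Suc i) j"] mon2_closed[of 0 1] mon2_closed[of "Suc i" j] assms t_pos
    by (intro bexI[of _ "mon2 0 1"] bexI[of _ "mon2 (Suc i) j"]) (simp_all del: One_nat_def)
next
  case second
  then show ?thesis
    using bracket_ham_x1[of "mon2 i (Suc j)"] mon2_closed[of 1 0] mon2_closed[of i "Suc j"] assms t_pos
    by (intro bexI[of _ "mon2 i (Suc j)"] bexI[of _ "mon2 1 0"]) (simp_all del: One_nat_def)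
qed

section \<open>The special algebra and its derived algebra as Hamiltonian fields\<close>

lemma A_support:
  assumes "f \<in> A" "f a \<noteq> 0"
  obtains i j where "a = idx i j" "i \<le> t1" "j \<le> t2"
  using assms multi_indices_iff[of a] by (auto simp: dp_carrier_def)

lemma special_eq: "(special 2 m :: ('a, 'a witt_elem) lie_structure) = W\<lparr>lcarrier := ham ` A\<rparr>"
proof -
  let ?K = "{u \<in> lcarrier W. witt_div 2 u = 0}"
  have "lie_span (W\<lparr>lcarrier := ?K\<rparr>) {br u v | u v. u \<in> ?K \<and> v \<in> ?K} = ham ` A"
  proof (rule lie_span_eqI)
    show "lie_subspace (W\<lparr>lcarrier := ?K\<rparr>) (ham ` A)"
      by (rule ham_subspace) (auto simp: ham_closed witt_div_ham)
    show "{br u v | u v. u \<in> ?K \<and> v \<in> ?K} \<subseteq> ham ` A"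
      using bracket_div_free by (auto intro!: imageI dp_carrier_diff)
    fix V assume V: "lie_subspace (W\<lparr>lcarrier := ?K\<rparr>) V"
      and sub: "{br u v | u v. u \<in> ?K \<and> v \<in> ?K} \<subseteq> V"
    have br: "br u v \<in> V" if "u \<in> ?K" "v \<in> ?K" for u v using that sub by blast
    have *: "ham (mon2 i j) \<in> V" if "i \<le> t1" "j \<le> t2" for i j
    proof (cases "i < t1 \<or> j < t2")
      case True
      then show ?thesis using ham_mon2_commutator[OF that] br by (auto simp: ham_closed witt_div_ham)
    next
      case False
      \<comment> \<open>These are X^(t1, 0) D2 and X^(0, t2) D1. Each coefficient avoids the
        variable of its derivation, so both are divergence free; the coefficients multiply to the
        top monomial with binomial factor 1.\<close>
      let ?u = "witt_term (mon2 t1 0) 2" and ?v = "witt_term (mon2 0 t2) 1"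
      have uv: "?u \<in> ?K" "?v \<in> ?K"
        by (auto simp: carrier_witt witt_term_def witt_div_2 mon2_closed
            dp_deriv_mon2[unfolded One_nat_def])
      then have "br ?u ?v = ham (mul (?u 2) (?v 1) - mul (?u 1) (?v 2))"
        by (intro bracket_div_free) auto
      also have "\<dots> = ham (mon2 t1 t2)" by (simp add: witt_term_def mul_mon2)
      finally show ?thesis using br[OF uv] False that by simp
    qed
    have "ham (dp_monom a) \<in> V" if "f \<in> A" "f a \<noteq> 0" for f a
      by (rule A_support[OF that]) (use * in simp)
    then have "ham f \<in> V" if "f \<in> A" for f
      using ham_monom_span[OF V that] that by blast
    then show "ham ` A \<subseteq> V" by blast
  qed
  then show ?thesis
    unfolding special_def lie_derived_def lie_commutator_def by simp
qed

lemma derived_special_eq: "lie_derived (W\<lparr>lcarrier := ham ` A\<rparr>) = W\<lparr>lcarrier := ham ` B\<rparr>"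
proof -
  have "lie_span (W\<lparr>lcarrier := ham ` A\<rparr>) {br u v | u v. u \<in> ham ` A \<and> v \<in> ham ` A} = ham ` B"
  proof (rule lie_span_eqI)
    show "lie_subspace (W\<lparr>lcarrier := ham ` A\<rparr>) (ham ` B)"
      by (rule ham_subspace) auto
    have leib: "dp_deriv j (mul f g) = mul (dp_deriv j f) g + mul f (dp_deriv j g)"
      if "f \<in> A" "g \<in> A" "j = 1 \<or> j = 2" for f g j
      using dp_deriv_mult[OF prime, of j 2 f m g] that by auto
    have "br (ham f) (ham g) \<in> ham ` B" if fg: "f \<in> A" "g \<in> A" for f g
    proof -
      \<comment> \<open>Expanding the right side, the two terms with the mixed second derivative of
        \<open>g\<close> cancel. The potential is thus a difference of derivatives and has no top
        coefficient.\<close>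
      have "mul (dp_deriv 2 f) (dp_deriv 1 g) - mul (dp_deriv 1 f) (dp_deriv 2 g) =
          dp_deriv 2 (mul f (dp_deriv 1 g)) - dp_deriv 1 (mul f (dp_deriv 2 g))"
        using fg dp_deriv_commute[of 1 2 g] by (simp add: leib dp_deriv_closed)
      moreover have "dp_deriv 2 (mul f (dp_deriv 1 g)) - dp_deriv 1 (mul f (dp_deriv 2 g)) \<in> B"
        using deriv_in_B[of "mul f (dp_deriv 1 g)"] deriv_in_B[of "mul f (dp_deriv 2 g)"]
        by (auto simp: dp_carrier_diff)
      ultimately show ?thesis unfolding bracket_ham[OF fg] by simp
    qed
    then show "{br u v | u v. u \<in> ham ` A \<and> v \<in> ham ` A} \<subseteq> ham ` B" by blast
    fix V assume V: "lie_subspace (W\<lparr>lcarrier := ham ` A\<rparr>) V"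
      and sub: "{br u v | u v. u \<in> ham ` A \<and> v \<in> ham ` A} \<subseteq> V"
    have *: "ham (mon2 i j) \<in> V" if "i \<le> t1" "j \<le> t2" "i < t1 \<or> j < t2" for i j
      using ham_mon2_commutator[OF that] sub by blast
    have mono: "ham (dp_monom a) \<in> V" if f: "f \<in> B" "f a \<noteq> 0" for f a
    proof -
      have "f \<in> A" using f(1) by simp
      then obtain i j where ij: "a = idx i j" "i \<le> t1" "j \<le> t2" using f(2) by (rule A_support)
      have "i < t1 \<or> j < t2"
      proof (rule ccontr)
        assume "\<not> ?thesis"
        then have "a = idx t1 t2" using ij by simp
        then show False using f by blast
      qed
      then show ?thesis using * ij by simp
    qed
    have "ham f \<in> V" if "f \<in> B" for f
    proof (rule ham_monom_span[OF V])
      show "f \<in> A" using that by simp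
    qed (rule mono[OF that])
    then show "ham ` B \<subseteq> V" by blast
  qed
  then show ?thesis
    unfolding lie_derived_def lie_commutator_def by simp
qed

end

text \<open>Used with nilpotent derivations, to pass from a nonzero element to a nonzero element
  that they annihilate.\<close>

lemma last_nonzero_iterate:
  assumes "(T ^^ N) u = 0" "u \<noteq> 0"
  obtains k where "(T ^^ k) u \<noteq> 0" "T ((T ^^ k) u) = 0"
proof -
  let ?k = "LEAST k. (T ^^ k) u = 0"
  have z: "(T ^^ ?k) u = 0" by (rule LeastI) (rule assms(1))
  then have "?k \<noteq> 0" using assms(2) by (cases "?k = 0") auto
  then obtain k where k: "?k = Suc k" using not0_implies_Suc by blast
  then have "k < ?k" by simp
  then have "(T ^^ k) u \<noteq> 0" by (rule not_less_Least)
  moreover have "T ((T ^^ k) u) = 0" using z unfolding k by simp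
  ultimately show ?thesis by (rule that)
qed

lemma funpow_closed: "(\<And>x. x \<in> I \<Longrightarrow> T x \<in> I) \<Longrightarrow> x \<in> I \<Longrightarrow> (T ^^ k) x \<in> I"
  by (induction k) auto

lemma dp_deriv_funpow: "(dp_deriv j ^^ k) f = (\<lambda>a. f (a(j := a j + k)))"
proof (induction k)
  case (Suc k)
  show ?case unfolding funpow.simps o_def Suc.IH unfolding dp_deriv_def by (simp del: fun_upd_apply add: fun_upd_same)
qed simp

text \<open>On Witt elements this is the bracket with the constant field D_j. The componentwise form
  lets nilpotency and commutation carry over from \<open>dp_deriv\<close>.\<close>

definition witt_deriv :: "nat \<Rightarrow> 'a::field witt_elem \<Rightarrow> 'a witt_elem" where
  "witt_deriv j u = (\<lambda>k. dp_deriv j (u k))"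

lemma witt_deriv_ham: "witt_deriv j (ham f) = ham (dp_deriv j f)"
  by (auto simp: witt_deriv_def ham_def dp_deriv_minus dp_deriv_commute[of j])

lemma witt_deriv_zero [simp]: "witt_deriv j 0 = 0"
  by (rule ext) (simp add: witt_deriv_def)

lemma witt_deriv_commute: "witt_deriv i (witt_deriv j u) = witt_deriv j (witt_deriv i u)"
  by (simp add: witt_deriv_def dp_deriv_commute[of i])

lemma witt_deriv_funpow: "(witt_deriv j ^^ k) u = (\<lambda>l. (dp_deriv j ^^ k) (u l))"
  by (induction k) (simp_all add: witt_deriv_def)

section \<open>Dimension and simplicity of the derived algebra\<close>

context special_two
begin

text \<open>\<open>ham\<close> kills constants, so potentials cannot be compared directly. The
  second component at (t1 - 1, t2) is, up to sign, the top coefficient of the potential.\<close>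

lemma ham_top_notin: "ham (mon2 t1 t2) \<notin> ham ` B"
proof
  assume "ham (mon2 t1 t2) \<in> ham ` B"
  then obtain f where f: "f \<in> B" "ham (mon2 t1 t2) = ham f" by blast
  have "dp_deriv 1 (mon2 t1 t2) = dp_deriv 1 f"
    using fun_cong[OF f(2), of 2] by simp
  then have "dp_deriv 1 (mon2 t1 t2) (idx (t1 - 1) t2) = dp_deriv 1 f (idx (t1 - 1) t2)" by simp
  then show False using f t_pos by (simp add: dp_deriv_def dp_monom_def)
qed

text \<open>A basis of the smaller space, extended by the field of the top monomial, is a basis of
  the larger one.\<close>

lemma dim_derived:
  "vector_space.dim witt_scale (ham ` A) = Suc (vector_space.dim witt_scale (ham ` B))"
proof -
  interpret vs: vector_space "witt_scale :: 'a \<Rightarrow> _" by (rule vector_space_witt_scale)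
  let ?T = "(ham :: 'a dp \<Rightarrow> _) ` dp_monom ` multi_indices CHAR('a) 2 m"
  have lsub: "vs.subspace U" if "lie_subspace (W\<lparr>lcarrier := C\<rparr>) U" for C U
    using that unfolding vs.subspace_def lie_subspace_update by simp
  have sub: "lie_subspace (W\<lparr>lcarrier := ham ` A\<rparr>) (ham ` B)" by (rule ham_subspace) auto
  have span: "ham f \<in> vs.span ?T" if "f \<in> A" for f
  proof (rule ham_monom_span[OF _ that])
    show "lie_subspace (W\<lparr>lcarrier := UNIV\<rparr>) (vs.span ?T)"
      unfolding lie_subspace_update by (simp add: vs.span_zero vs.span_add vs.span_scale)
    fix a assume "f a \<noteq> 0"
    then have "a \<in> multi_indices CHAR('a) 2 m" using that by (simp add: dp_carrier_def)
    then show "ham (dp_monom a) \<in> vs.span ?T" by (intro vs.span_base) simp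
  qed
  obtain Bs where Bs: "Bs \<subseteq> ham ` B" "vs.independent Bs" "ham ` B \<subseteq> vs.span Bs"
    "card Bs = vs.dim (ham ` B)" using vs.basis_exists by blast
  have "Bs \<subseteq> vs.span ?T" using Bs(1) span by blast
  moreover have "finite ?T" by (intro finite_imageI finite_multi_indices)
  \<comment> \<open>Finiteness matters because \<open>card\<close> of an infinite set is 0 and would
    not grow on inserting a vector.\<close>
  ultimately have fin: "finite Bs" using vs.independent_span_bound[OF _ Bs(2), of ?T] by simp
  have "vs.span Bs \<subseteq> ham ` B" using vs.span_minimal[OF Bs(1) lsub[OF sub]] .
  then have top: "ham (mon2 t1 t2) \<notin> vs.span Bs" using ham_top_notin by blast
  have "vs.dim (ham ` A) = card (insert (ham (mon2 t1 t2)) Bs)"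
  proof (rule vs.dim_unique[OF _ _ _ refl])
    show "insert (ham (mon2 t1 t2)) Bs \<subseteq> ham ` A" using Bs(1) by (auto simp: mon2_closed)
    show "vs.independent (insert (ham (mon2 t1 t2)) Bs)"
      using vs.independent_insertI[OF top Bs(2)] .
    show "ham ` A \<subseteq> vs.span (insert (ham (mon2 t1 t2)) Bs)"
    proof
      fix u assume "u \<in> ham ` A"
      then obtain f where f: "f \<in> A" "u = ham f" by blast
      let ?c = "f (idx t1 t2)"
      let ?g = "f - (\<lambda>a. ?c * mon2 t1 t2 a)"
      have "?g \<in> B" using f(1) by (simp add: dp_carrier_diff dp_carrier_scale mon2_closed)
        (simp add: dp_monom_def)
      then have "ham ?g \<in> vs.span (insert (ham (mon2 t1 t2)) Bs)"
        using Bs(3) vs.span_mono[of Bs "insert (ham (mon2 t1 t2)) Bs"] by blast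
      moreover have "u = ham ?g + witt_scale ?c (ham (mon2 t1 t2))"
        by (simp only: f(2) ham_diff ham_scale diff_add_cancel)
      ultimately show "u \<in> vs.span (insert (ham (mon2 t1 t2)) Bs)"
        by (simp add: vs.span_add vs.span_scale vs.span_base)
    qed
  qed
  then show ?thesis using fin top vs.span_base[of _ Bs] Bs(4) by (subst (asm) card_insert_disjoint) auto
qed

lemma lie_algebra_special: "lie_algebra (W\<lparr>lcarrier := ham ` A\<rparr>)"
proof (rule lie_algebra.subalgebra[OF lie_algebra_witt[OF prime]])
  have "ham ` A \<subseteq> lcarrier W" by (auto simp: ham_closed)
  from ham_subspace[OF _ this] show "lie_subspace W (ham ` A)" by simp
  show "lbracket W u v \<in> ham ` A" if "u \<in> ham ` A" "v \<in> ham ` A" for u v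
    using that by (auto simp: bracket_ham intro!: imageI dp_carrier_diff)
qed

lemma lie_algebra_special_derived: "lie_algebra (W\<lparr>lcarrier := ham ` B\<rparr>)"
  using lie_algebra.lie_algebra_derived[OF lie_algebra_special] by (simp only: derived_special_eq)

lemma funpow_deriv_zero:
  assumes "f \<in> A"
  shows "(dp_deriv 1 ^^ Suc t1) f = 0" "(dp_deriv 2 ^^ Suc t2) f = 0"
proof -
  have z: "f b = 0" if "b 1 > t1 \<or> b 2 > t2" for b
    by (rule ccontr, rule A_support[OF assms]) (use that in auto)
  show "(dp_deriv 1 ^^ Suc t1) f = 0" "(dp_deriv 2 ^^ Suc t2) f = 0"
    unfolding dp_deriv_funpow by (auto intro!: ext z)
qed

text \<open>A nonzero coefficient at (i, j) with i > 0 reappears in D1 f at (i - 1, j), and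
  similarly for j and D2.\<close>

lemma deriv_zero_const:
  assumes f: "f \<in> A" and z: "dp_deriv 1 f = 0" "dp_deriv 2 f = 0"
  shows "f = (\<lambda>a. f (idx 0 0) * mon2 0 0 a)"
proof
  fix a
  show "f a = f (idx 0 0) * mon2 0 0 a"
  proof (cases "f a = 0")
    case True
    then show ?thesis by (auto simp: dp_monom_def)
  next
    case False
    then obtain i j where a: "a = idx i j" using A_support[OF f] by blast
    have "dp_deriv 1 f (idx (i - 1) j) = 0" "dp_deriv 2 f (idx i (j - 1)) = 0" using z by simp_all
    then have "i = 0" "j = 0" using False a by (cases i; cases j; simp add: dp_deriv_def)+
    then show ?thesis using a by (simp add: dp_monom_def)
  qed
qed

lemma dp_const_mult: "g \<in> A \<Longrightarrow> mul (\<lambda>a. c * mon2 0 0 a) g = (\<lambda>a. c * g a)"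
  by (simp only: dp_mult_scale_left mul_one)

lemma special_derived_simple:
  assumes t: "t1 \<ge> 2" "t2 \<ge> 2"
  shows "simple_lie_algebra (W\<lparr>lcarrier := ham ` B\<rparr>)"
proof -
  have ideal: "I = ham ` B" if I: "lie_ideal (W\<lparr>lcarrier := ham ` B\<rparr>) I" and I0: "I \<noteq> {0}" for I
  proof -
    have sub: "lie_subspace (W\<lparr>lcarrier := ham ` B\<rparr>) I"
      and abs: "\<And>u v. u \<in> ham ` B \<Longrightarrow> v \<in> I \<Longrightarrow> br u v \<in> I"
      using I by (auto simp: lie_ideal_def)
    have IB: "I \<subseteq> ham ` B" and I_zero: "0 \<in> I"
      and scale: "\<And>c u. u \<in> I \<Longrightarrow> witt_scale c u \<in> I"
      using sub by (auto simp: lie_subspace_update)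
    have minus: "- u \<in> I" if "u \<in> I" for u
    proof -
      have "witt_scale (- 1) u = - u" by (intro ext) (simp add: witt_scale_def)
      then show ?thesis using scale[OF that, of "- 1"] by (simp only:)
    qed
    have abs': "br u v \<in> I" if "u \<in> I" "v \<in> ham ` B" for u v
      using minus[OF abs[OF that(2,1)]] by (simp only: witt_bracket_skew[of _ _ u v])
    have mon: "ham (mon2 i j) \<in> ham ` B" if "i \<le> t1" "j \<le> t2" "i < t1 \<or> j < t2" for i j
      using mon2_in_B[OF that] by (rule imageI)
    \<comment> \<open>The constant fields D1 and -D2 belong to the algebra, so the ideal is stable
      under both partial derivatives.\<close>
    have d1: "witt_deriv 1 u \<in> I" if "u \<in> I" for u
      using abs[OF mon[of 0 1] that] that IB t
      by (auto simp: bracket_x2_ham[unfolded One_nat_def] witt_deriv_ham)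
    have d2: "witt_deriv 2 u \<in> I" if "u \<in> I" for u
      using abs'[OF that mon[of 1 0]] that IB t
      by (auto simp: bracket_ham_x1[unfolded One_nat_def] witt_deriv_ham)
    obtain u where u: "u \<in> I" "u \<noteq> 0" using I0 I_zero by blast
    have nil: "(witt_deriv 1 ^^ Suc t1) w = 0" "(witt_deriv 2 ^^ Suc t2) w = 0" if "w \<in> I" for w
    proof -
      have "w \<in> lcarrier W" using that IB by (auto simp: ham_closed)
      then show "(witt_deriv 1 ^^ Suc t1) w = 0" "(witt_deriv 2 ^^ Suc t2) w = 0"
        unfolding witt_deriv_funpow by (auto intro!: ext simp only: funpow_deriv_zero carrier_wittD
            zero_fun_apply)
    qed
    \<comment> \<open>D1 is applied until one more application would give zero, then D2 likewise. As
      they commute, both annihilate the result, which is a nonzero constant field.\<close>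
    obtain k where k: "(witt_deriv 1 ^^ k) u \<noteq> 0" "witt_deriv 1 ((witt_deriv 1 ^^ k) u) = 0"
      using last_nonzero_iterate[OF nil(1)[OF u(1)] u(2)] by blast
    let ?v = "(witt_deriv 1 ^^ k) u"
    have v: "?v \<in> I" using funpow_closed[of I, OF d1 u(1)] .
    obtain l where l: "(witt_deriv 2 ^^ l) ?v \<noteq> 0" "witt_deriv 2 ((witt_deriv 2 ^^ l) ?v) = 0"
      using last_nonzero_iterate[OF nil(2)[OF v] k(1)] by blast
    define w where "w = (witt_deriv 2 ^^ l) ?v"
    have w: "w \<in> I" unfolding w_def using funpow_closed[of I, OF d2 v] .
    have "witt_deriv 1 ((witt_deriv 2 ^^ n) x) = (witt_deriv 2 ^^ n) (witt_deriv 1 x)"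
      for n and x :: "'a witt_elem"
      by (induction n) (simp_all add: witt_deriv_commute[of "Suc 0" 2])
    moreover have "(witt_deriv 2 ^^ n) 0 = (0 :: 'a witt_elem)" for n
      by (induction n) (simp_all del: zero_fun_apply)
    ultimately have "witt_deriv 1 w = 0" unfolding w_def using k(2) by simp
    moreover have "witt_deriv 2 w = 0" unfolding w_def using l(2) .
    ultimately have w0: "witt_deriv 1 w = 0" "witt_deriv 2 w = 0" by blast+
    obtain f where f: "f \<in> B" "w = ham f" using w IB by blast
    have "w \<in> lcarrier W" using f ham_closed by blast
    then have "w k = (\<lambda>a. w k (idx 0 0) * mon2 0 0 a)" for k
      using fun_cong[OF w0(1), of k] fun_cong[OF w0(2), of k]
      by (intro deriv_zero_const carrier_wittD) (simp_all only: witt_deriv_def zero_fun_apply)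
    then obtain c where c: "\<And>k. w k = (\<lambda>a. c k * mon2 0 0 a)" by meson
    \<comment> \<open>Bracketing with the constant field w = c 1 D1 + c 2 D2 applies this operator
      to the potential \<open>g\<close>.\<close>
    have wbr: "witt_scale (c 2) (ham (dp_deriv 2 g)) + witt_scale (c 1) (ham (dp_deriv 1 g)) \<in> I"
      if g: "g \<in> B" for g
    proof -
      have gA: "g \<in> A" and fA: "f \<in> A" using g f(1) by simp_all
      have "br w (ham g) = ham (mul (w 2) (dp_deriv 2 g) + mul (w 1) (dp_deriv 1 g))"
        unfolding f(2) bracket_ham[OF fA gA] by (simp add: dp_mult_minus_left)
      also have "\<dots> = witt_scale (c 2) (ham (dp_deriv 2 g)) + witt_scale (c 1) (ham (dp_deriv 1 g))"
        unfolding c dp_const_mult[OF dp_deriv_closed[OF gA]] ham_add ham_scale ..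
      finally show ?thesis using abs'[OF w imageI[OF g]] by simp
    qed
    have unscale: "ham h \<in> I" if "witt_scale d (ham h) \<in> I" "d \<noteq> 0" for d h
    proof -
      have "witt_scale (1 / d) (witt_scale d (ham h)) = ham h"
        using that(2) by (intro ext) (simp add: witt_scale_def)
      then show ?thesis using scale[OF that(1), of "1 / d"] by (simp only:)
    qed
    have scale_0: "witt_scale d 0 = 0" for d :: 'a by (intro ext) (simp add: witt_scale_def)
    \<comment> \<open>D2 kills X^(2, 0), which isolates the term with \<open>c 1\<close>; the
      exponent 2 requires t1 \<ge> 2.\<close>
    have x1: "ham (mon2 1 0) \<in> I" if "c 1 \<noteq> 0"
    proof (rule unscale[OF _ that])
      have d: "dp_deriv 1 (mon2 2 0 :: 'a dp) = mon2 1 0" "dp_deriv 2 (mon2 2 0 :: 'a dp) = 0"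
        by (simp_all only: dp_deriv_mon2) auto
      show "witt_scale (c 1) (ham (mon2 1 0)) \<in> I"
        using wbr[OF mon2_in_B[of 2 0]] t by (simp only: d scale_0 ham_zero add_0) simp
    qed
    have x2: "ham (mon2 0 1) \<in> I" if "c 2 \<noteq> 0"
    proof (rule unscale[OF _ that])
      have d: "dp_deriv 2 (mon2 0 2 :: 'a dp) = mon2 0 1" "dp_deriv 1 (mon2 0 2 :: 'a dp) = 0"
        by (simp_all only: dp_deriv_mon2) auto
      show "witt_scale (c 2) (ham (mon2 0 1)) \<in> I"
        using wbr[OF mon2_in_B[of 0 2]] t by (simp only: d scale_0 ham_zero add_0_right) simp
    qed
    have der1: "ham (dp_deriv 1 g) \<in> I" if "ham (mon2 0 1) \<in> I" "g \<in> B" for g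
      using abs'[OF that(1) imageI[OF that(2)]] that(2) by (simp only: bracket_x2_ham mem_Collect_eq)
    have der2: "ham (dp_deriv 2 g) \<in> I" if "ham (mon2 1 0) \<in> I" "g \<in> B" for g
      using abs[OF imageI[OF that(2)] that(1)] that(2) by (simp only: bracket_ham_x1 mem_Collect_eq)
    \<comment> \<open>Either constant field yields the other: D1 sends X^(2, 0) to X^(1, 0), the
      potential of -D2, and symmetrically.\<close>
    have x12: "ham (mon2 1 0) \<in> I" if "ham (mon2 0 1) \<in> I"
      using der1[OF that mon2_in_B[of 2 0]] t by (simp add: dp_deriv_mon2[unfolded One_nat_def])
    have x21: "ham (mon2 0 1) \<in> I" if "ham (mon2 1 0) \<in> I"
      using der2[OF that mon2_in_B[of 0 2]] t by (simp add: dp_deriv_mon2[unfolded One_nat_def])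
    have "c 1 \<noteq> 0 \<or> c 2 \<noteq> 0"
    proof (rule ccontr)
      assume n: "\<not> ?thesis"
      have "w k = 0" for k
      proof (cases "k = 1 \<or> k = 2")
        case True
        then have "c k = 0" using n by auto
        then show ?thesis by (subst c) (simp add: fun_eq_iff)
      qed (simp add: f(2) ham_def)
      then have "w = 0" by (intro ext) simp
      then show False using l(1) w_def by simp
    qed
    then have X1: "ham (mon2 1 0) \<in> I" and X2: "ham (mon2 0 1) \<in> I"
      using x1 x2 x12 x21 by blast+
    \<comment> \<open>These monomials have an antiderivative monomial in \<open>B\<close>. Among the
      non-top ones only (t1 - 1, t2) and (t1, t2 - 1) are missed, whose sole antiderivative monomial
      is the top one.\<close>
    have inner: "ham (mon2 i j) \<in> I"
      if "i < t1 \<and> j \<le> t2 \<and> (Suc i < t1 \<or> j < t2) \<or> i \<le> t1 \<and> j < t2 \<and> (i < t1 \<or> Suc j < t2)" for i j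
      using that
    proof
      assume *: "i < t1 \<and> j \<le> t2 \<and> (Suc i < t1 \<or> j < t2)"
      then have "mon2 (Suc i) j \<in> B" by (intro mon2_in_B) auto
      from der1[OF X2 this] show ?thesis by (simp add: dp_deriv_mon2[unfolded One_nat_def])
    next
      assume *: "i \<le> t1 \<and> j < t2 \<and> (i < t1 \<or> Suc j < t2)"
      then have "mon2 i (Suc j) \<in> B" by (intro mon2_in_B) auto
      from der2[OF X1 this] show ?thesis by (simp add: dp_deriv_mon2[unfolded One_nat_def])
    qed
    \<comment> \<open>t1 + 1 and t2 + 1 are positive powers of the characteristic, so t1 and t2 are
      -1 in the field.\<close>
    have ts: "of_nat t1 \<noteq> (0 :: 'a)" "of_nat t2 \<noteq> (0 :: 'a)"
    proof -
      have "of_nat (CHAR('a) ^ k - 1) \<noteq> (0 :: 'a)" if "k > 0" for k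
        using that prime_gt_0_nat[OF prime] by (simp add: of_nat_diff of_nat_power zero_power)
      then show "of_nat t1 \<noteq> (0 :: 'a)" "of_nat t2 \<noteq> (0 :: 'a)"
        using m_pos by (simp_all add: t1_def t2_def)
    qed
    \<comment> \<open>The field of X^(2, 0), already in the ideal, is bracketed with that of X^(t1 -
      1, t2), known only to lie in the algebra. The product X^(1, 0) X^(t1 - 1, t2 - 1) carries the
      invertible binomial t1.\<close>
    have edge1: "ham (mon2 t1 (t2 - 1)) \<in> I"
    proof (rule unscale[of "- of_nat t1"])
      have "br (ham (mon2 2 0)) (ham (mon2 (t1 - 1) t2)) =
          ham (- mul (mon2 1 0) (mon2 (t1 - 1) (t2 - 1)))"
        using t by (subst bracket_ham)
          (simp_all add: mon2_closed dp_deriv_mon2 dp_deriv_mon2[unfolded One_nat_def])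
      also have "\<dots> = ham (\<lambda>a. - of_nat t1 * mon2 t1 (t2 - 1) a)"
        using t by (subst mul_mon2, simp, simp, intro arg_cong[of _ _ ham] ext) simp
      also have "\<dots> = witt_scale (- of_nat t1) (ham (mon2 t1 (t2 - 1)))" by (rule ham_scale)
      finally show "witt_scale (- of_nat t1) (ham (mon2 t1 (t2 - 1))) \<in> I"
        using abs'[OF inner[of 2 0] mon[of "t1 - 1" t2]] t by simp
    qed (use ts in simp)
    have edge2: "ham (mon2 (t1 - 1) t2) \<in> I"
    proof (rule unscale[of "of_nat t2"])
      have "br (ham (mon2 0 2)) (ham (mon2 t1 (t2 - 1))) =
          ham (mul (mon2 0 1) (mon2 (t1 - 1) (t2 - 1)))"
        using t by (subst bracket_ham)
          (simp_all add: mon2_closed dp_deriv_mon2 dp_deriv_mon2[unfolded One_nat_def])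
      also have "\<dots> = ham (\<lambda>a. of_nat t2 * mon2 (t1 - 1) t2 a)"
        using t by (subst mul_mon2, simp, simp, intro arg_cong[of _ _ ham] ext) simp
      also have "\<dots> = witt_scale (of_nat t2) (ham (mon2 (t1 - 1) t2))" by (rule ham_scale)
      finally show "witt_scale (of_nat t2) (ham (mon2 (t1 - 1) t2)) \<in> I"
        using abs'[OF inner[of 0 2] mon[of t1 "t2 - 1"]] t by simp
    qed (use ts in simp)
    have all: "ham (mon2 i j) \<in> I" if "i \<le> t1" "j \<le> t2" "i < t1 \<or> j < t2" for i j
    proof -
      have "i = t1 \<and> j = t2 - 1 \<or> i = t1 - 1 \<and> j = t2 \<or>
        (i < t1 \<and> j \<le> t2 \<and> (Suc i < t1 \<or> j < t2) \<or> i \<le> t1 \<and> j < t2 \<and> (i < t1 \<or> Suc j < t2))"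
        using that by (cases "i < t1"; cases "j < t2") auto
      then show ?thesis using edge1 edge2 inner by blast
    qed
    have "ham f \<in> I" if f: "f \<in> B" for f
    proof (rule ham_monom_span[OF sub])
      show "f \<in> A" using f by simp
      fix a assume a: "f a \<noteq> 0"
      obtain i j where ij: "a = idx i j" "i \<le> t1" "j \<le> t2" using A_support[of f a] a f by blast
      have "i \<noteq> t1 \<or> j \<noteq> t2" using a f ij(1) by blast
      then have "i < t1 \<or> j < t2" using ij(2,3) by auto
      then show "ham (dp_monom a) \<in> I" using all[of i j] ij by simp
    qed
    then show ?thesis using IB by blast
  qed
  have "ham (mon2 0 1) \<in> ham ` B" "ham (mon2 2 0) \<in> ham ` B"
    using mon2_in_B[of 0 1] mon2_in_B[of 2 0] t by auto
  moreover have "br (ham (mon2 0 1)) (ham (mon2 2 0)) \<noteq> 0"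
  proof
    assume "br (ham (mon2 0 1)) (ham (mon2 2 0)) = 0"
    then have "ham (mon2 1 0) = (0 :: 'a witt_elem)"
      using bracket_x2_ham[of "mon2 2 0"] mon2_closed[of 2 0] t by (simp add: dp_deriv_mon2[unfolded One_nat_def])
    from fun_cong[OF fun_cong[OF this, of 2], of "idx 0 0"] show False
      by (simp add: dp_deriv_mon2[unfolded One_nat_def]) (simp add: dp_monom_def)
  qed
  ultimately show ?thesis
    unfolding simple_lie_algebra_def using ideal lie_algebra_special_derived by fastforce
qed

end

section \<open>The nilradical for m = (1, m2)\<close>

context special_two
begin

text \<open>For \<^term>\<open>t1 = 1\<close>, the component \<open>u 2\<close> of \<open>u = ham f\<close> does not involve the first variable,
  and \<open>u \<mapsto> u 2\<close> maps the special algebra onto a Witt algebra in the second variable.\<close>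

definition nil_part :: "'a witt_elem set" where
  "nil_part = {u \<in> ham ` A. u 2 = 0}"

text \<open>The second component is -D1 f, and D1 D1 = 0 because the first exponent is at most
  1.\<close>

lemma deriv1_ham_2:
  assumes "t1 = 1" "u \<in> ham ` A"
  shows "dp_deriv 1 (u 2) = 0"
proof -
  obtain f where f: "f \<in> A" "u = ham f" using assms(2) by blast
  have "f (a(Suc 0 := Suc (Suc (a (Suc 0))))) = 0" for a
    by (rule ccontr, erule A_support[OF f(1)]) (use assms(1) in \<open>auto dest!: fun_cong[of _ _ "Suc 0"]\<close>)
  then show ?thesis unfolding f(2) by (intro ext) (simp add: dp_deriv_def)
qed

text \<open>The terms with D1 vanish, leaving on second components the bracket of a Witt algebra in
  the second variable.\<close>

lemma bracket_2:
  assumes "t1 = 1" "u \<in> ham ` A" "v \<in> ham ` A"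
  shows "br u v 2 = mul (u 2) (dp_deriv 2 (v 2)) - mul (v 2) (dp_deriv 2 (u 2))"
proof -
  have "br u v 2 = (mul (u 1) (dp_deriv 1 (v 2)) - mul (v 1) (dp_deriv 1 (u 2))) +
      (mul (u 2) (dp_deriv 2 (v 2)) - mul (v 2) (dp_deriv 2 (u 2)))"
    unfolding witt_bracket_def by (rule sum_1_2)
  then show ?thesis by (simp only: deriv1_ham_2 assms dp_mult_zero_right diff_self add_0)
qed

lemma ham_A_bracket: "u \<in> ham ` A \<Longrightarrow> v \<in> ham ` A \<Longrightarrow> br u v \<in> ham ` A"
  by (auto simp: bracket_ham intro!: imageI dp_carrier_diff)

lemma nil_part_subspace:
  assumes "nil_part \<subseteq> C"
  shows "lie_subspace (W\<lparr>lcarrier := C\<rparr>) nil_part"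
proof -
  have "lie_subspace (W\<lparr>lcarrier := ham ` A\<rparr>) (ham ` A)" by (rule ham_subspace) auto
  then have "0 \<in> ham ` A" "\<And>u v. u \<in> ham ` A \<Longrightarrow> v \<in> ham ` A \<Longrightarrow> u + v \<in> ham ` A"
    "\<And>c u. u \<in> ham ` A \<Longrightarrow> witt_scale c u \<in> ham ` A"
    by (auto simp only: lie_subspace_update witt_sel)
  moreover have "witt_scale c u 2 = 0" if "u 2 = 0" for c and u :: "'a witt_elem"
    by (rule ext) (simp add: witt_scale_def that)
  ultimately show ?thesis
    using assms unfolding lie_subspace_update witt_sel by (auto simp: nil_part_def)
qed

lemma nil_part_bracket:
  assumes "t1 = 1" "u \<in> ham ` A" "v \<in> nil_part"
  shows "br u v \<in> nil_part"
proof -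
  have v: "v \<in> ham ` A" "v 2 = 0" using assms(3) by (simp_all add: nil_part_def)
  have "br u v 2 = 0"
    unfolding bracket_2[OF assms(1,2) v(1)] v(2) by (simp only: dp_deriv_zero dp_mult_zero_left
        dp_mult_zero_right diff_self)
  then show ?thesis using ham_A_bracket[OF assms(2) v(1)] by (simp add: nil_part_def)
qed

lemma nil_part_ideal:
  assumes "t1 = 1" "nil_part \<subseteq> C" "C \<subseteq> ham ` A"
  shows "lie_ideal (W\<lparr>lcarrier := C\<rparr>) nil_part"
  unfolding lie_ideal_def using nil_part_subspace[OF assms(2)] nil_part_bracket assms by auto

text \<open>When both second components vanish, so does the potential u2 v1 - u1 v2 of the bracket;
  hence this part is abelian.\<close>

lemma nil_part_nilpotent: "lie_nilpotent (W\<lparr>lcarrier := nil_part\<rparr>)"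
proof -
  have zero: "0 \<in> nil_part" using nil_part_subspace[OF subset_refl] by (simp add: lie_subspace_update)
  have br: "br u v = 0" if uv: "u \<in> nil_part" "v \<in> nil_part" for u v
  proof -
    obtain f g where fg: "f \<in> A" "g \<in> A" "u = ham f" "v = ham g" "u 2 = 0" "v 2 = 0"
      using uv by (auto simp: nil_part_def)
    have "br u v = ham (mul (u 2) (v 1) - mul (u 1) (v 2))"
      using fg by (intro bracket_div_free) (simp_all add: ham_closed witt_div_ham)
    then show ?thesis by (simp only: fg(5,6) dp_mult_zero_left dp_mult_zero_right diff_self ham_zero)
  qed
  have "lie_span (W\<lparr>lcarrier := nil_part\<rparr>) {br u v | u v. u \<in> nil_part \<and> v \<in> nil_part} = {0}"
  proof (rule lie_span_eqI)
    have "witt_scale c 0 = 0" for c :: 'a by (intro ext) (simp add: witt_scale_def)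
    then show "lie_subspace (W\<lparr>lcarrier := nil_part\<rparr>) {0}"
      using zero by (simp add: lie_subspace_update)
    show "{br u v | u v. u \<in> nil_part \<and> v \<in> nil_part} \<subseteq> {0}" using br by blast
  qed (simp add: lie_subspace_update)
  then have "lower_central (W\<lparr>lcarrier := nil_part\<rparr>) (Suc 0) = {lzero (W\<lparr>lcarrier := nil_part\<rparr>)}"
    by (simp add: lie_commutator_def)
  then show ?thesis unfolding lie_nilpotent_def by blast
qed

text \<open>An ideal element with nonzero second component produces \<open>w\<close> with second component \<open>1\<close> and
  \<open>e\<close> with second component \<open>-x2\<close>; since \<open>br e\<close> preserves second component \<open>1\<close>,
  the lower central series of the ideal never vanishes.\<close>

lemma nilpotent_ideal_subset:
  assumes t: "t1 = 1" "t2 \<ge> 2"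
    and I: "lie_ideal (W\<lparr>lcarrier := ham ` A\<rparr>) I" and nil: "lie_nilpotent (W\<lparr>lcarrier := I\<rparr>)"
  shows "I \<subseteq> nil_part"
proof (rule ccontr)
  assume n: "\<not> I \<subseteq> nil_part"
  have abs: "\<And>u v. u \<in> ham ` A \<Longrightarrow> v \<in> I \<Longrightarrow> br u v \<in> I"
    and IA: "I \<subseteq> ham ` A" and scale: "\<And>c u. u \<in> I \<Longrightarrow> witt_scale c u \<in> I"
    using I by (auto simp: lie_ideal_def lie_subspace_update)
  obtain u where u: "u \<in> I" "u 2 \<noteq> 0" using n IA by (auto simp: nil_part_def)
  have comp: "v k \<in> A" if "v \<in> I" for v k
    using that IA carrier_wittD[of v 2 m k] by (auto simp: ham_closed)
  obtain k where k: "(dp_deriv 2 ^^ k) (u 2) \<noteq> 0" "dp_deriv 2 ((dp_deriv 2 ^^ k) (u 2)) = 0"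
    using last_nonzero_iterate[OF funpow_deriv_zero(2)[OF comp[OF u(1)]] u(2)] by blast
  have d2: "witt_deriv 2 v \<in> I" if v: "v \<in> I" for v
  proof -
    obtain f where f: "f \<in> A" "v = ham f" using v IA by blast
    \<comment> \<open>\<open>ham (- mon2 1 0)\<close> is D2, so bracketing with it from the left is
      \<open>witt_deriv 2\<close>.\<close>
    have "ham (- mon2 1 0) \<in> ham ` A" using t by (intro imageI dp_carrier_minus mon2_closed) auto
    from abs[OF this v] have "br (ham (- mon2 1 0)) v \<in> I" .
    also have "br (ham (- mon2 1 0)) v = ham (dp_deriv 2 f)"
      unfolding f(2) using t f(1)
      by (subst bracket_ham)
        (simp_all add: dp_carrier_minus mon2_closed dp_deriv_minus dp_deriv_mon2[unfolded One_nat_def]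
          dp_mult_minus_left mul_one dp_deriv_closed)
    also have "\<dots> = witt_deriv 2 v"
      unfolding f(2) witt_deriv_ham ..
    finally show ?thesis .
  qed
  define v where "v = (witt_deriv 2 ^^ k) u"
  have v: "v \<in> I" unfolding v_def using funpow_closed[of I, OF d2 u(1)] .
  have v2: "v 2 = (dp_deriv 2 ^^ k) (u 2)" unfolding v_def witt_deriv_funpow ..
  have "v \<in> ham ` A" using v IA by blast
  then have "dp_deriv 1 (v 2) = 0" by (rule deriv1_ham_2[OF t(1)])
  moreover have "dp_deriv 2 (v 2) = 0" unfolding v2 by (rule k(2))
  ultimately obtain c where c: "v 2 = (\<lambda>a. c * mon2 0 0 a)"
    using deriv_zero_const[OF comp[OF v, of 2]] by blast
  have "c \<noteq> 0"
  proof
    assume "c = 0"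
    then have "v 2 = 0" unfolding c by (intro ext) simp
    then show False using k(1) v2 by simp
  qed
  define w where "w = witt_scale (1 / c) v"
  have w: "w \<in> I" unfolding w_def by (rule scale[OF v])
  have w2: "w 2 = mon2 0 0"
    unfolding w_def using \<open>c \<noteq> 0\<close> by (intro ext) (simp add: witt_scale_def c)
  \<comment> \<open>The field of -X^(1, 2) has second component X^(0, 2), and [X^(0, 2) D2, D2] =
    -X^(0, 1) D2. The exponent 2 is available since t2 \<ge> 2.\<close>
  define e where "e = br (ham (- mon2 1 2)) w"
  have x12: "ham (- mon2 1 2) \<in> ham ` A"
    using t by (intro imageI dp_carrier_minus mon2_closed) auto
  have e: "e \<in> I" unfolding e_def by (rule abs[OF x12 w])
  have one: "dp_deriv 2 (mon2 0 0 :: 'a dp) = 0" "dp_deriv 2 (mon2 0 2 :: 'a dp) = mon2 0 1"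
    "dp_deriv 2 (mon2 0 1 :: 'a dp) = mon2 0 0" "dp_deriv 1 (mon2 1 2 :: 'a dp) = mon2 0 2"
    by (simp_all only: dp_deriv_mon2) auto
  have e2: "e 2 = - mon2 0 1"
  proof -
    have "e 2 = mul (mon2 0 2) (dp_deriv 2 (mon2 0 0)) - mul (mon2 0 0) (dp_deriv 2 (mon2 0 2))"
      unfolding e_def using bracket_2[OF t(1) x12, of w] w IA
      by (simp add: w2 subset_iff dp_deriv_minus one[unfolded One_nat_def])
    also have "\<dots> = - mon2 0 1"
      using t mul_one[OF mon2_closed[of 0 1]] by (simp only: one dp_mult_zero_right diff_0)
    finally show ?thesis .
  qed
  have step: "br e v 2 = mon2 0 0" if v: "v \<in> I" "v 2 = mon2 0 0" for v
  proof -
    have "br e v 2 = mul (- mon2 0 1) (dp_deriv 2 (mon2 0 0)) - mul (mon2 0 0) (dp_deriv 2 (- mon2 0 1))"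
      using bracket_2[OF t(1), of e v] e v IA by (simp add: e2 subset_iff)
    also have "\<dots> = mon2 0 0"
      by (simp only: dp_deriv_minus one dp_mult_zero_right dp_mult_minus_right mul_one[OF mon2_closed])
        simp
    finally show ?thesis .
  qed
  have "\<exists>v\<in>lower_central (W\<lparr>lcarrier := I\<rparr>) k. v \<in> I \<and> v 2 = mon2 0 0" for k
  proof (induction k)
    case 0
    show ?case using w w2 by auto
  next
    case (Suc k)
    then obtain v where v: "v \<in> lower_central (W\<lparr>lcarrier := I\<rparr>) k" "v \<in> I" "v 2 = mon2 0 0" by blast
    have "br e v \<in> lower_central (W\<lparr>lcarrier := I\<rparr>) (Suc k)"
      using e v(1) by (auto simp: lie_commutator_def lie_span_def)
    moreover have "br e v \<in> I" using abs e v(2) IA by blast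
    ultimately show ?case using step[OF v(2,3)] by blast
  qed
  moreover obtain k where "lower_central (W\<lparr>lcarrier := I\<rparr>) k = {0}"
    using nil by (auto simp: lie_nilpotent_def)
  ultimately have "(0 :: 'a witt_elem) 2 = mon2 0 0" by (metis singletonD)
  from fun_cong[OF this, of "idx 0 0"] show False by (simp add: dp_monom_def)
qed

text \<open>The order behind \<open>GREATEST\<close> is inclusion, so it is enough that
  \<open>nil_part\<close> is a nilpotent ideal containing every other one.\<close>

lemma nilradical_special:
  assumes "t1 = 1" "t2 \<ge> 2"
  shows "nilradical (W\<lparr>lcarrier := ham ` A\<rparr>) = nil_part"
  unfolding nilradical_def
proof (rule Greatest_equality)
  have "nil_part \<subseteq> ham ` A" by (auto simp: nil_part_def)
  then show "lie_ideal (W\<lparr>lcarrier := ham ` A\<rparr>) nil_part \<and>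
      lie_nilpotent (W\<lparr>lcarrier := ham ` A, lcarrier := nil_part\<rparr>)"
    using nil_part_ideal[OF assms(1)] nil_part_nilpotent by simp
next
  fix I
  assume "lie_ideal (W\<lparr>lcarrier := ham ` A\<rparr>) I \<and>
    lie_nilpotent (W\<lparr>lcarrier := ham ` A, lcarrier := I\<rparr>)"
  then show "I \<le> nil_part" using nilpotent_ideal_subset[OF assms] by simp
qed

end

section \<open>The Witt algebra in one variable as a quotient\<close>

text \<open>Sets the first variable to zero and renames the second as the only variable of the
  one-variable algebra, whose multi-indices are the \<open>idx i 0\<close>.\<close>

definition restrict_second :: "'a::field dp \<Rightarrow> 'a dp" where
  "restrict_second g = (\<lambda>a. if a = idx (a 1) 0 then g (idx 0 (a 1)) else 0)"

lemma restrict_second_deriv: "dp_deriv 1 (restrict_second g) = restrict_second (dp_deriv 2 g)"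
proof
  fix a :: "nat \<Rightarrow> nat"
  have "a(1 := Suc (a 1)) = idx (Suc (a 1)) 0 \<longleftrightarrow> a = idx (a 1) 0"
  proof
    assume eq: "a(1 := Suc (a 1)) = idx (Suc (a 1)) 0"
    have "a i = idx (a 1) 0 i" for i
      using fun_cong[OF eq, of i] by (auto simp: idx_def split: if_splits)
    then show "a = idx (a 1) 0" ..
  next
    assume a: "a = idx (a 1) 0"
    show "a(1 := Suc (a 1)) = idx (Suc (a 1)) 0" by (subst a) simp
  qed
  then show "dp_deriv 1 (restrict_second g) a = restrict_second (dp_deriv 2 g) a"
    by (simp add: dp_deriv_def restrict_second_def)
qed

lemma restrict_second_diff: "restrict_second (f - g) = restrict_second f - restrict_second g"
  and restrict_second_add: "restrict_second (f + g) = restrict_second f + restrict_second g"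
  and restrict_second_scale: "restrict_second (\<lambda>a. c * f a) = (\<lambda>a. c * restrict_second f a)"
  by (rule ext, simp add: restrict_second_def)+

lemma witt_term_closed: "f \<in> dp_carrier n m \<Longrightarrow> j \<in> {1..n} \<Longrightarrow> witt_term f j \<in> lcarrier (witt n m)"
  by (auto simp: carrier_witt witt_term_def)

lemma witt_term_diff: "witt_term (f - g) j = witt_term f j - witt_term g j"
  and witt_term_add: "witt_term (f + g) j = witt_term f j + witt_term g j"
  and witt_term_scale: "witt_term (\<lambda>a. c * f a) j = witt_scale c (witt_term f j)"
  and witt_term_zero: "witt_term 0 j = 0"
  by (intro ext, simp add: witt_term_def witt_scale_def)+

lemma witt_term_eq_iff: "witt_term f j = witt_term g j \<longleftrightarrow> f = g"
  by (metis witt_term_def)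

context special_two
begin

abbreviation A1 :: "'a dp set" where "A1 \<equiv> dp_carrier 1 (\<lambda>_. m 2)"
abbreviation W1 :: "('a, 'a witt_elem) lie_structure" where "W1 \<equiv> witt 1 (\<lambda>_. m 2)"

lemma multi_indices_1_iff:
  "a \<in> multi_indices CHAR('a) 1 (\<lambda>_. m 2) \<longleftrightarrow> a = idx (a 1) 0 \<and> a 1 \<le> t2"
proof
  assume a: "a \<in> multi_indices CHAR('a) 1 (\<lambda>_. m 2)"
  then have z: "a i = 0" if "i \<noteq> 1" for i using that by (simp add: multi_indices_def)
  have "a i = idx (a 1) 0 i" for i using z[of i] by (simp add: idx_def)
  then have "a = idx (a 1) 0" by (intro ext)
  moreover have "a 1 \<le> t2" using a by (simp add: multi_indices_def t2_def)
  ultimately show "a = idx (a 1) 0 \<and> a 1 \<le> t2" ..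
next
  assume a: "a = idx (a 1) 0 \<and> a 1 \<le> t2"
  have "a i = 0" if "i \<noteq> 1" for i
    by (subst conjunct1[OF a]) (use that in \<open>simp add: idx_def\<close>)
  then show "a \<in> multi_indices CHAR('a) 1 (\<lambda>_. m 2)"
    using conjunct2[OF a] by (simp add: multi_indices_def t2_def)
qed

lemma A1_outside: "f \<in> A1 \<Longrightarrow> a \<noteq> idx (a 1) 0 \<or> a 1 > t2 \<Longrightarrow> f a = 0"
  using multi_indices_1_iff[of a] by (auto simp: dp_carrier_def)

lemma restrict_second_closed:
  assumes "g \<in> A"
  shows "restrict_second g \<in> A1"
  unfolding dp_carrier_def
proof (intro CollectI allI impI)
  fix a assume "restrict_second g a \<noteq> 0"
  then have a: "a = idx (a 1) 0" "g (idx 0 (a 1)) \<noteq> 0"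
    by (auto simp: restrict_second_def split: if_splits)
  then have "a 1 \<le> t2" using A_outside[OF assms, of 0 "a 1"] by force
  with a(1) show "a \<in> multi_indices CHAR('a) 1 (\<lambda>_. m 2)" by (simp only: multi_indices_1_iff)
qed

text \<open>Splittings of (0, i) consist of pairs (0, x), (0, y) with x + y = i; they match the
  one-variable splittings and have the same binomials.\<close>

lemma restrict_second_mult:
  "dp_mult 1 (\<lambda>_. m 2) (restrict_second g) (restrict_second h) = restrict_second (mul g h)"
proof
  fix c
  show "dp_mult 1 (\<lambda>_. m 2) (restrict_second g) (restrict_second h) c = restrict_second (mul g h) c"
  proof (cases "c \<in> multi_indices CHAR('a) 1 (\<lambda>_. m 2)")
    case False
    then have "restrict_second (mul g h) c = 0"
      using multi_indices_1_iff[of c] dp_mult_outside[of "idx 0 (c 1)" 2 m g h]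
      by (auto simp: restrict_second_def)
    then show ?thesis by (simp only: dp_mult_outside[OF False])
  next
    case True
    then obtain i where c: "c = idx i 0" "i \<le> t2" using multi_indices_1_iff[of c] by blast
    have mem: "idx 0 i \<in> multi_indices CHAR('a) 2 m" using c by simp
    have l: "fst q = idx (fst q 1) 0 \<and> snd q = idx (snd q 1) 0" if "fst q + snd q = idx i 0" for q
    proof -
      have z: "fst q k + snd q k = idx i 0 k" for k using fun_cong[OF that, of k] by simp
      have "fst q k = idx (fst q 1) 0 k" "snd q k = idx (snd q 1) 0 k" for k
        using z[of k] by (auto simp: idx_def split: if_splits)
      then show ?thesis by (intro conjI ext)
    qed
    have r: "fst q = idx 0 (fst q 2) \<and> snd q = idx 0 (snd q 2)" if "fst q + snd q = idx 0 i" for q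
    proof -
      have z: "fst q k + snd q k = idx 0 i k" for k using fun_cong[OF that, of k] by simp
      have "fst q k = idx 0 (fst q 2) k" "snd q k = idx 0 (snd q 2) k" for k
        using z[of k] by (auto simp: idx_def split: if_splits)
      then show ?thesis by (intro conjI ext)
    qed
    have b: "mbinom 1 (idx x 0) (idx y 0) = (mbinom 2 (idx 0 x) (idx 0 y) :: 'a)" for x y
      unfolding mbinom_def prod_1_2 by simp
    let ?F = "\<lambda>q. mbinom 1 (fst q) (snd q) * restrict_second g (fst q) * restrict_second h (snd q)"
    let ?G = "\<lambda>q. mbinom 2 (fst q) (snd q) * g (fst q) * h (snd q)"
    have S1: "{q. fst q + snd q = idx i 0} = (\<lambda>(x, y). (idx x 0, idx y 0)) ` {(x, y). x + y = i}"
    proof (intro set_eqI iffI)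
      fix q assume q: "q \<in> {q. fst q + snd q = idx i 0}"
      have "fst q 1 + snd q 1 = i" using fun_cong[OF CollectD[OF q], of 1] by simp
      moreover have "q = (idx (fst q 1) 0, idx (snd q 1) 0)"
        using l[of q] q by (intro prod_eqI) (simp_all only: fst_conv snd_conv mem_Collect_eq)
      ultimately show "q \<in> (\<lambda>(x, y). (idx x 0, idx y 0)) ` {(x, y). x + y = i}"
        by (intro image_eqI[of _ _ "(fst q 1, snd q 1)"]) (simp_all only: case_prod_conv mem_Collect_eq)
    qed (auto simp: idx_add)
    have S2: "{q. fst q + snd q = idx 0 i} = (\<lambda>(x, y). (idx 0 x, idx 0 y)) ` {(x, y). x + y = i}"
    proof (intro set_eqI iffI)
      fix q assume q: "q \<in> {q. fst q + snd q = idx 0 i}"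
      have "fst q 2 + snd q 2 = i" using fun_cong[OF CollectD[OF q], of 2] by simp
      moreover have "q = (idx 0 (fst q 2), idx 0 (snd q 2))"
        using r[of q] q by (intro prod_eqI) (simp_all only: fst_conv snd_conv mem_Collect_eq)
      ultimately show "q \<in> (\<lambda>(x, y). (idx 0 x, idx 0 y)) ` {(x, y). x + y = i}"
        by (intro image_eqI[of _ _ "(fst q 2, snd q 2)"]) (simp_all only: case_prod_conv mem_Collect_eq)
    qed (auto simp: idx_add)
    have "dp_mult 1 (\<lambda>_. m 2) (restrict_second g) (restrict_second h) c = sum ?F {q. fst q + snd q = idx i 0}"
      unfolding dp_mult_apply[OF True] by (simp only: split_def c(1))
    also have "\<dots> = (\<Sum>p | fst p + snd p = i. ?F (idx (fst p) 0, idx (snd p) 0))"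
      unfolding S1 by (subst sum.reindex) (auto simp: inj_on_def split_def)
    also have "\<dots> = (\<Sum>p | fst p + snd p = i. ?G (idx 0 (fst p), idx 0 (snd p)))"
      by (simp add: b[unfolded One_nat_def] restrict_second_def)
    also have "\<dots> = sum ?G {q. fst q + snd q = idx 0 i}"
      unfolding S2 by (subst sum.reindex) (auto simp: inj_on_def split_def)
    also have "\<dots> = mul g h (idx 0 i)"
      unfolding dp_mult_apply[OF mem] by (simp only: split_def)
    finally show ?thesis by (simp add: c restrict_second_def)
  qed
qed

text \<open>In characteristic 2 the bracket coefficient f g' - g f' equals (f g)', which has no top
  monomial. Conversely, \<open>v\<close> without top monomial has an antiderivative g, and v D =
  [D, g D].\<close>

lemma derived_witt_1:
  assumes "t1 = 1"
  shows "lie_derived W1 = W1\<lparr>lcarrier := {witt_term v 1 | v. v \<in> A1 \<and> v (idx t2 0) = 0}\<rparr>"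
proof -
  let ?C = "{witt_term v 1 | v. v \<in> A1 \<and> v (idx t2 0) = 0}"
  \<comment> \<open>\<open>t1 = 1\<close> makes a positive power of the characteristic equal to 2,
    so the characteristic is 2 and signs disappear.\<close>
  have "CHAR('a) ^ m 1 = 2" using assms unfolding t1_def by simp
  then have "CHAR('a) dvd 2" using m_pos(1) by (metis dvd_power)
  then have char2: "CHAR('a) = 2" using prime primes_dvd_imp_eq two_is_prime_nat by blast
  have "(2 :: 'a) = of_nat CHAR('a)" by (simp add: char2)
  then have "x + x = 0" for x :: 'a by (simp only: mult_2[symmetric] of_nat_CHAR mult_zero_left)
  then have neg: "- x = x" for x :: 'a by (simp add: neg_eq_iff_add_eq_0)
  have W1_term: "u = witt_term (u 1) 1" if "u \<in> lcarrier W1" for u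
    using that by (intro ext) (auto simp: carrier_witt witt_term_def)
  have brk: "witt_bracket 1 (\<lambda>_. m 2) (witt_term v 1) (witt_term w 1) =
      witt_term (dp_mult 1 (\<lambda>_. m 2) v (dp_deriv 1 w) - dp_mult 1 (\<lambda>_. m 2) w (dp_deriv 1 v)) 1"
    for v w :: "'a dp"
    by (subst witt_bracket_term) (simp_all add: witt_term_diff)
  have C: "?C \<subseteq> lcarrier W1" by (auto intro!: witt_term_closed)
  have "lie_span W1 {witt_bracket 1 (\<lambda>_. m 2) u v | u v. u \<in> lcarrier W1 \<and> v \<in> lcarrier W1} = ?C"
  proof (rule lie_span_eqI)
    show "lie_subspace W1 ?C"
      unfolding lie_subspace_def witt_sel
    proof (intro conjI ballI allI)
      show "0 \<in> ?C" by (intro CollectI exI[of _ 0]) (simp add: witt_term_zero)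
      fix x y assume "x \<in> ?C" "y \<in> ?C"
      then obtain v w where "x = witt_term v 1" "y = witt_term w 1" "v \<in> A1" "w \<in> A1"
        "v (idx t2 0) = 0" "w (idx t2 0) = 0" by blast
      then show "x + y \<in> ?C"
        by (intro CollectI exI[of _ "v + w"]) (simp add: witt_term_add dp_carrier_add)
    next
      fix c x assume "x \<in> ?C"
      then obtain v where "x = witt_term v 1" "v \<in> A1" "v (idx t2 0) = 0" by blast
      then show "witt_scale c x \<in> ?C"
        by (intro CollectI exI[of _ "\<lambda>a. c * v a"]) (simp add: witt_term_scale dp_carrier_scale)
    qed (rule C)
    show "{witt_bracket 1 (\<lambda>_. m 2) u v | u v. u \<in> lcarrier W1 \<and> v \<in> lcarrier W1} \<subseteq> ?C"
    proof clarify
      fix u v assume uv: "u \<in> lcarrier W1" "v \<in> lcarrier W1"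
      let ?f = "u 1" and ?g = "v 1"
      have fg: "?f \<in> A1" "?g \<in> A1" using uv carrier_wittD by blast+
      let ?h = "dp_mult 1 (\<lambda>_. m 2) ?f (dp_deriv 1 ?g) - dp_mult 1 (\<lambda>_. m 2) ?g (dp_deriv 1 ?f)"
      have "?h = dp_deriv 1 (dp_mult 1 (\<lambda>_. m 2) ?f ?g)"
      proof -
        have dif: "f - g = g + f" for f g :: "'a dp"
        proof
          fix a
          have "f a - g a = f a + (- g a)" by simp
          then show "(f - g) a = (g + f) a" unfolding neg by (simp add: add.commute)
        qed
        have "dp_deriv 1 (dp_mult 1 (\<lambda>_. m 2) ?f ?g) =
            dp_mult 1 (\<lambda>_. m 2) (dp_deriv 1 ?f) ?g + dp_mult 1 (\<lambda>_. m 2) ?f (dp_deriv 1 ?g)"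
          by (rule dp_deriv_mult[OF prime _ fg]) simp
        then show ?thesis by (simp only: dif dp_mult_commute[of _ _ ?g "dp_deriv 1 ?f"])
      qed
      moreover have "dp_deriv 1 (dp_mult 1 (\<lambda>_. m 2) ?f ?g) (idx t2 0) = 0"
        using A1_outside[OF dp_mult_closed, of "idx (Suc t2) 0"] by (simp add: dp_deriv_def)
      ultimately have "?h (idx t2 0) = 0" by (simp only:)
      moreover have "?h \<in> A1" by (intro dp_carrier_diff dp_mult_closed)
      moreover have "witt_bracket 1 (\<lambda>_. m 2) u v = witt_term ?h 1"
        using brk[of ?f ?g] W1_term[OF uv(1)] W1_term[OF uv(2)] by (simp only:)
      ultimately show "\<exists>w. witt_bracket 1 (\<lambda>_. m 2) u v = witt_term w 1 \<and> w \<in> A1 \<and> w (idx t2 0) = 0"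
        by blast
    qed
    fix V assume sub: "{witt_bracket 1 (\<lambda>_. m 2) u v | u v. u \<in> lcarrier W1 \<and> v \<in> lcarrier W1} \<subseteq> V"
    then have brV: "witt_bracket 1 (\<lambda>_. m 2) u v \<in> V" if "u \<in> lcarrier W1" "v \<in> lcarrier W1" for u v
      using that by blast
    show "?C \<subseteq> V"
    proof clarify
      fix v assume v: "v \<in> A1" "v (idx t2 0) = 0"
      \<comment> \<open>The antiderivative of \<open>v\<close>, with exponents raised by one; the
        missing top coefficient of \<open>v\<close> keeps it within the index set.\<close>
      define g where "g = (\<lambda>a. if a = idx (a 1) 0 \<and> a 1 > 0 then v (idx (a 1 - 1) 0) else 0)"
      have gA: "g \<in> A1"
        unfolding dp_carrier_def
      proof (intro CollectI allI impI)
        fix a assume "g a \<noteq> 0"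
        then have a: "a = idx (a 1) 0" "a 1 > 0" "v (idx (a 1 - 1) 0) \<noteq> 0"
          by (auto simp: g_def split: if_splits)
        have "a 1 - 1 \<le> t2" using a(3) A1_outside[OF v(1), of "idx (a 1 - 1) 0"] by force
        moreover have "a 1 - 1 \<noteq> t2" using a(3) v(2) by metis
        ultimately have "a 1 \<le> t2" by linarith
        then show "a \<in> multi_indices CHAR('a) 1 (\<lambda>_. m 2)" unfolding multi_indices_1_iff using a(1) by blast
      qed
      have dg: "dp_deriv 1 g = v"
      proof
        fix a :: "nat \<Rightarrow> nat"
        show "dp_deriv 1 g a = v a"
        proof (cases "a = idx (a 1) 0")
          case True
          have "dp_deriv 1 g (idx i 0) = v (idx i 0)" for i by (simp add: dp_deriv_def g_def)
          then show ?thesis using True by metis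
        next
          case False
          have "a(1 := Suc (a 1)) \<noteq> idx (Suc (a 1)) 0"
          proof
            assume eq: "a(1 := Suc (a 1)) = idx (Suc (a 1)) 0"
            have "a i = idx (a 1) 0 i" for i
              using fun_cong[OF eq, of i] by (auto simp: idx_def split: if_splits)
            then show False using False by blast
          qed
          then have "dp_deriv 1 g a = 0" by (simp add: dp_deriv_def g_def)
          then show ?thesis using A1_outside[OF v(1), of a] False by simp
        qed
      qed
      let ?one = "dp_monom 0 :: 'a dp"
      have one: "?one \<in> A1" by (rule dp_monom_closed) (simp add: multi_indices_def)
      have "dp_deriv 1 ?one = 0" by (simp add: dp_deriv_monom)
      then have eq: "witt_bracket 1 (\<lambda>_. m 2) (witt_term ?one 1) (witt_term g 1) = witt_term v 1"
        unfolding brk dg by (simp only: dp_mult_one[OF v(1)] dp_mult_zero_right diff_0_right)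
      have "witt_term ?one 1 \<in> lcarrier W1" "witt_term g 1 \<in> lcarrier W1"
        by (simp_all only: witt_term_closed one gA atLeastAtMost_iff order_refl)
      from brV[OF this] show "witt_term v 1 \<in> V" unfolding eq .
    qed
  qed
  then show ?thesis unfolding lie_derived_def lie_commutator_def by simp
qed

text \<open>For \<open>t1 = 1\<close> the top coefficient of \<open>f\<close> is the coefficient of
  D1 f at (0, t2), and D1 f = 0 here.\<close>

lemma nil_part_in_B:
  assumes "t1 = 1"
  shows "nil_part \<subseteq> ham ` B"
proof
  fix u assume "u \<in> nil_part"
  then obtain f where f: "f \<in> A" "u = ham f" "dp_deriv 1 f = 0" by (auto simp: nil_part_def)
  have "dp_deriv 1 f (idx 0 t2) = 0" unfolding f(3) by simp
  then have "f (idx t1 t2) = 0" using assms by (simp add: dp_deriv_def)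
  then show "u \<in> ham ` B" using f by blast
qed

lemma restrict_second_eq_0:
  assumes "g \<in> A" "dp_deriv 1 g = 0" "restrict_second g = 0"
  shows "g = 0"
proof
  fix a
  show "g a = 0 a"
  proof (rule ccontr)
    assume "g a \<noteq> 0 a"
    then have ga: "g a \<noteq> 0" by simp
    then obtain i j where a: "a = idx i j" using A_support[OF assms(1)] by blast
    have "dp_deriv 1 g (idx (i - 1) j) = 0" unfolding assms(2) by simp
    then have "i = 0" using ga a by (cases i) (simp_all add: dp_deriv_def)
    moreover have "restrict_second g (idx j 0) = 0" unfolding assms(3) by simp
    ultimately show False using ga a by (simp add: restrict_second_def)
  qed
qed

text \<open>The isomorphism theorem is applied to the map taking the coefficient of D2, which
  absorbs the sign of \<open>ham\<close>. Its kernel is \<open>nil_part\<close> because restriction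
  is injective on elements free of the first variable.\<close>

lemma special_quotient:
  assumes t: "t1 = 1"
  shows "lie_isomorphic (lie_quotient (W\<lparr>lcarrier := ham ` B\<rparr>) nil_part) (lie_derived W1)"
proof (rule lie_isomorphic_quotient[where \<psi> = "\<lambda>u. witt_term (restrict_second (u 2)) 1"])
  let ?\<psi> = "\<lambda>u :: 'a witt_elem. witt_term (restrict_second (u 2)) 1"
  let ?C = "{witt_term v 1 | v. v \<in> A1 \<and> v (idx t2 0) = 0}"
  have comp: "u 2 \<in> A" "u \<in> ham ` A" if "u \<in> ham ` B" for u
    using that by (auto simp: dp_carrier_minus dp_deriv_closed)
  show "lie_algebra (W\<lparr>lcarrier := ham ` B\<rparr>)" by (rule lie_algebra_special_derived)
  show "lie_algebra (lie_derived W1)"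
    by (rule lie_algebra.lie_algebra_derived[OF lie_algebra_witt[OF prime]])
  have "?\<psi> ` ham ` B = ?C"
  proof (intro set_eqI iffI)
    fix x assume "x \<in> ?\<psi> ` ham ` B"
    then obtain f where f: "f \<in> B" "x = ?\<psi> (ham f)" by blast
    have "restrict_second (ham f 2) (idx t2 0) = 0"
      using f(1) t by (simp add: restrict_second_def dp_deriv_def)
    then show "x \<in> ?C" using f restrict_second_closed[OF comp(1)[of "ham f"]] by blast
  next
    fix x assume "x \<in> ?C"
    then obtain v where v: "v \<in> A1" "v (idx t2 0) = 0" "x = witt_term v 1" by blast
    \<comment> \<open>This is -x1 v(x2), so that the second component -D1 f of its field is
      v(x2).\<close>
    define f where "f = (\<lambda>a. if a = idx 1 (a 2) then - v (idx (a 2) 0) else 0)"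
    have "f \<in> A"
      unfolding dp_carrier_def
    proof (intro CollectI allI impI)
      fix a assume "f a \<noteq> 0"
      then have a: "a = idx 1 (a 2)" "v (idx (a 2) 0) \<noteq> 0" by (auto simp: f_def split: if_splits)
      have "a 2 \<le> t2" using a(2) A1_outside[OF v(1), of "idx (a 2) 0"] by force
      then show "a \<in> multi_indices CHAR('a) 2 m" using a(1) t unfolding multi_indices_iff by auto
    qed
    moreover have "f (idx t1 t2) = 0" using t v(2) by (simp add: f_def)
    moreover have "restrict_second (ham f 2) = v"
    proof
      fix a :: "nat \<Rightarrow> nat"
      show "restrict_second (ham f 2) a = v a"
      proof (cases "a = idx (a 1) 0")
        case True
        have "restrict_second (ham f 2) (idx i 0) = v (idx i 0)" for i
          by (simp add: restrict_second_def dp_deriv_def f_def)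
        then show ?thesis using True by metis
      next
        case False
        then show ?thesis using A1_outside[OF v(1), of a] by (simp add: restrict_second_def)
      qed
    qed
    ultimately show "x \<in> ?\<psi> ` ham ` B" unfolding v(3) by (intro image_eqI[of _ _ "ham f"]) auto
  qed
  then show "?\<psi> ` lcarrier (W\<lparr>lcarrier := ham ` B\<rparr>) = lcarrier (lie_derived W1)"
    unfolding derived_witt_1[OF t] by simp
  show "?\<psi> (ladd (W\<lparr>lcarrier := ham ` B\<rparr>) x y) = ladd (lie_derived W1) (?\<psi> x) (?\<psi> y)" for x y
    by (simp add: lie_derived_def restrict_second_add witt_term_add)
  show "?\<psi> (lscale (W\<lparr>lcarrier := ham ` B\<rparr>) c x) = lscale (lie_derived W1) c (?\<psi> x)" for c x
  proof -
    have "witt_scale c x 2 = (\<lambda>a. c * x 2 a)" by (simp add: witt_scale_def)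
    then show ?thesis by (simp add: lie_derived_def restrict_second_scale witt_term_scale)
  qed
  show "?\<psi> (lbracket (W\<lparr>lcarrier := ham ` B\<rparr>) x y) = lbracket (lie_derived W1) (?\<psi> x) (?\<psi> y)"
    if "x \<in> lcarrier (W\<lparr>lcarrier := ham ` B\<rparr>)" "y \<in> lcarrier (W\<lparr>lcarrier := ham ` B\<rparr>)" for x y
  proof -
    have xy: "x \<in> ham ` A" "y \<in> ham ` A" using that comp(2) by auto
    have "?\<psi> (br x y) = witt_term (dp_mult 1 (\<lambda>_. m 2) (restrict_second (x 2)) (dp_deriv 1 (restrict_second (y 2))) -
        dp_mult 1 (\<lambda>_. m 2) (restrict_second (y 2)) (dp_deriv 1 (restrict_second (x 2)))) 1"
      unfolding bracket_2[OF t xy] restrict_second_diff restrict_second_deriv restrict_second_mult ..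
    also have "\<dots> = witt_bracket 1 (\<lambda>_. m 2) (?\<psi> x) (?\<psi> y)"
      by (subst witt_bracket_term) (simp_all add: witt_term_diff)
    finally show ?thesis by (simp add: lie_derived_def)
  qed
  have "restrict_second 0 = (0 :: 'a dp)" by (rule ext) (simp add: restrict_second_def)
  then have "u 2 = 0 \<longleftrightarrow> ?\<psi> u = 0" if "u \<in> ham ` B" for u
    using restrict_second_eq_0[OF comp(1)[OF that] deriv1_ham_2[OF t comp(2)[OF that]]]
      witt_term_eq_iff[of "restrict_second (u 2)" 1 0] by (auto simp only: witt_term_zero)
  then have "nil_part = {x \<in> ham ` B. ?\<psi> x = 0}"
    using nil_part_in_B[OF t] comp(2) unfolding nil_part_def by blast
  then show "nil_part = {x \<in> lcarrier (W\<lparr>lcarrier := ham ` B\<rparr>). ?\<psi> x = lzero (lie_derived W1)}"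
    by (simp add: lie_derived_def)
qed

end

theorem theorem3:
  fixes m :: "nat \<Rightarrow> nat"
    and S S' :: "('a::field, 'a witt_elem) lie_structure"
  assumes "CHAR('a) = 2"
    and "m 1 > 0" and "m 2 > 0" and "(m 1, m 2) \<noteq> (1, 1)"
    and "S = special 2 m" and "S' = lie_derived S"
  shows "(m 1 \<noteq> 1 \<and> m 2 \<noteq> 1 \<longrightarrow>
       int (vector_space.dim witt_scale (lcarrier S')) =
         int (vector_space.dim witt_scale (lcarrier S)) - 1 \<and>
       simple_lie_algebra S') \<and>
     (m 1 = 1 \<longrightarrow>
       lie_ideal S' (nilradical S) \<and>
       lie_isomorphic (lie_quotient S' (nilradical S)) (lie_derived (witt 1 (\<lambda>_. m 2))))"
proof -
  interpret special_two m "TYPE('a)"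
    using assms(1-3) by unfold_locales simp_all
  have S: "S = W\<lparr>lcarrier := ham ` A\<rparr>" using assms(5) special_eq by simp
  have S': "S' = W\<lparr>lcarrier := ham ` B\<rparr>" using assms(6) S derived_special_eq by simp
  have ge2: "(2 :: nat) ^ k - 1 \<ge> 2" if "k \<ge> 2" for k
    using power_increasing[OF that, of "2 :: nat"] by simp
  show ?thesis
  proof (intro conjI impI)
    assume m: "m 1 \<noteq> 1 \<and> m 2 \<noteq> 1"
    then have "t1 \<ge> 2" "t2 \<ge> 2" using ge2[of "m 1"] ge2[of "m 2"] assms(1-3) by (auto simp: t1_def t2_def)
    then show "simple_lie_algebra S'" unfolding S' by (rule special_derived_simple)
    show "int (vector_space.dim witt_scale (lcarrier S')) =
        int (vector_space.dim witt_scale (lcarrier S)) - 1"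
      unfolding S S' using dim_derived by simp
  next
    assume m: "m 1 = 1"
    then have t: "t1 = 1" by (simp add: t1_def assms(1))
    \<comment> \<open>Excluding (1, 1) gives t2 \<ge> 2, which puts X^(1, 2) at the disposal of the
      nilradical argument.\<close>
    have "m 2 \<ge> 2" using m assms(3,4) by auto
    then have "t2 \<ge> 2" using ge2 by (simp add: t2_def assms(1))
    with t have nil: "nilradical S = nil_part" unfolding S by (rule nilradical_special)
    show "lie_ideal S' (nilradical S)"
      unfolding nil S' by (rule nil_part_ideal[OF t nil_part_in_B[OF t]]) blast
    show "lie_isomorphic (lie_quotient S' (nilradical S)) (lie_derived (witt 1 (\<lambda>_. m 2)))"
      unfolding nil S' by (rule special_quotient[OF t])
  qed
qed

end
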